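(* Let $\Pi_n$ be a permutation of $[n]$ chosen uniformly at random and let $\alpha_n=\alpha(\Pi_n)$. Then asymptotically almost surely (i.e., with probability tending to $1$ as $n\to\infty$), \[ \left(\frac13+\frac1{60}+o(1)\right)n\le \alpha_n\le \left(\frac12-\frac1{120}+o(1)\right)n. \]
   Context: The shape of a permutation $(x_1,\dots,x_w)$ (a sequence of distinct integers) is $(s_1,\dots,s_{w-1})\in\{+,-\}^{w-1}$ with $s_i=+$ iff $x_i<x_{i+1}$. A sub-permutation of $\pi$ is a subsequence $(\pi(i_1),\dots,\pi(i_j))$ with $i_1<\dots<i_j$. The alternating shapes of length $w-1$ are $(+,-,+,-,\dots)$ and $(-,+,-,+,\dots)$. Alternating twins of length $w$ in $\pi$ are two disjoint (no common positions) sub-permutations of $\pi$, each of length $w$, having the same shape, this shape being one of the two alternating shapes. $\alpha(\pi)$ is the largest $w$ such that $\pi$ contains alternating twins of length $w$. *)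

theory Defs
  imports
    "HOL-Probability.Probability"
    "HOL-Combinatorics.Multiset_Permutations"
    "HOL-Library.Landau_Symbols"
begin

text \<open>
  A permutation is a list of distinct elements. The sign \<open>+\<close> is encoded as \<^const>\<open>True\<close> and
  \<open>-\<close> as \<^const>\<open>False\<close>; list positions start at 0.
\<close>

definition shape :: "'a::linorder list \<Rightarrow> bool list" where
  "shape xs = map (\<lambda>i. xs ! i < xs ! Suc i) [0..<length xs - 1]"

definition alternating_shapes :: "nat \<Rightarrow> bool list set" where
  "alternating_shapes m = {map even [0..<m], map odd [0..<m]}"

text \<open>
  A sub-permutation is given by its set \<open>A\<close> of positions and read off as \<open>nths xs A\<close>, so that
  disjointness is a condition on the position sets.
\<close>

definition alternating_twins :: "'a::linorder list \<Rightarrow> nat \<Rightarrow> nat set \<Rightarrow> nat set \<Rightarrow> bool" where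
  "alternating_twins xs w A B \<longleftrightarrow>
     A \<subseteq> {..<length xs} \<and> B \<subseteq> {..<length xs} \<and> A \<inter> B = {} \<and>
     length (nths xs A) = w \<and> length (nths xs B) = w \<and>
     shape (nths xs A) = shape (nths xs B) \<and>
     shape (nths xs A) \<in> alternating_shapes (w - 1)"

definition alternating_twin_lengths :: "'a::linorder list \<Rightarrow> nat set" where
  "alternating_twin_lengths xs = {w. \<exists>A B. alternating_twins xs w A B}"

definition alpha :: "'a::linorder list \<Rightarrow> nat" where
  "alpha xs = Max (alternating_twin_lengths xs)"

lemma finite_alternating_twin_lengths: "finite (alternating_twin_lengths xs)"
proof (rule finite_subset)
  show "alternating_twin_lengths xs \<subseteq> {..length xs}"
  proof
    fix w assume "w \<in> alternating_twin_lengths xs"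
    then obtain A where "w = length (nths xs A)"
      unfolding alternating_twin_lengths_def alternating_twins_def by blast
    also have "\<dots> = card {i. i < length xs \<and> i \<in> A}"
      by (rule length_nths)
    also have "\<dots> \<le> card {..<length xs}"
      by (rule card_mono) auto
    finally show "w \<in> {..length xs}" by simp
  qed
qed simp

lemma zero_mem_alternating_twin_lengths: "0 \<in> alternating_twin_lengths xs"
proof -
  have "alternating_twins xs 0 {} {}"
    by (simp add: alternating_twins_def shape_def alternating_shapes_def)
  then show ?thesis
    unfolding alternating_twin_lengths_def by blast
qed

definition random_permutation :: "nat \<Rightarrow> nat list pmf" where
  "random_permutation n = pmf_of_set (permutations_of_set {1..n})"

end

theory Submission
  imports Defs "HOL-Library.Sublist" "HOL-Real_Asymp.Real_Asymp"
begin

text \<open>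
  The number of windows of consecutive positions showing a given order pattern of length \<open>k\<close> is
  concentrated around \<open>n / k!\<close> (Chebyshev; disjoint windows are uncorrelated), so both bounds
  follow from deterministic inequalities in terms of such counts.

  Upper bound: an alternating subsequence has at most two entries in a monotone run and at most
  three in two adjacent runs, so twins leave at least as many positions unused as there are
  monotone windows of length 5. These have density \<open>2/5! = 1/60\<close>.

  Lower bound: the local extrema, of density \<open>2/3\<close>, form an alternating sequence. The remaining
  entries contain an alternating subsequence of density \<open>1/30\<close>, detected by \<open>24\<close> of the \<open>6!\<close> patterns
  of length 6. One twin uses the extrema of the first half and the non-extrema of the second half,
  the other one conversely, which gives \<open>(2/3 + 1/30) n / 2\<close>.
\<close>

section \<open>Concentration of pattern counts\<close>

text \<open>A pattern lists the offsets in a window by increasing value.\<close>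

definition order_pattern :: "nat \<Rightarrow> nat list \<Rightarrow> bool" where
  "order_pattern k \<sigma> \<longleftrightarrow> distinct \<sigma> \<and> set \<sigma> = {..<k}"

definition pattern_at :: "nat list \<Rightarrow> nat \<Rightarrow> 'a::linorder list \<Rightarrow> bool" where
  "pattern_at \<sigma> i xs \<longleftrightarrow> sorted_wrt (<) (map (\<lambda>j. xs ! (i + j)) \<sigma>)"

section \<open>Rearrangements of a single window\<close>

lemma permutes_mapping_list:
  assumes "distinct ts" "distinct us" "set ts = set us"
  obtains p where "p permutes set ts" "map p ts = us"
proof -
  define k where "k = length ts"
  have k: "length us = k"
    using assms unfolding k_def by (metis distinct_card)
  define W where "W = set ts"
  have b1: "bij_betw ((!) ts) {..<k} W"
    unfolding W_def k_def by (rule bij_betw_nth) (use assms in auto)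
  have b2: "bij_betw ((!) us) {..<k} W"
    unfolding W_def by (rule bij_betw_nth) (use assms k in auto)
  \<comment> \<open>Sends the entry of \<open>ts\<close> at each index to the entry of
    \<open>us\<close> at that index; \<open>p\<close> extends it by the identity outside the common
    set.\<close>
  define g where "g = (!) us \<circ> inv_into {..<k} ((!) ts)"
  have bg: "bij_betw g W W"
    unfolding g_def by (rule bij_betw_trans[OF bij_betw_inv_into[OF b1] b2])
  define p where "p = (\<lambda>j. if j \<in> W then g j else j)"
  have "bij_betw p W W"
    using bg by (subst bij_betw_cong[of _ _ g]) (auto simp: p_def)
  then have "p permutes W"
    by (rule bij_imp_permutes) (auto simp: p_def)
  moreover have "map p ts = us"
  proof (rule nth_equalityI)
    show "length (map p ts) = length us" using k k_def by simp
    fix j assume j: "j < length (map p ts)"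
    then have jk: "j < k" by (simp add: k_def)
    then have "inv_into {..<k} ((!) ts) (ts ! j) = j"
      using b1 by (auto simp: bij_betw_def inv_into_f_f)
    moreover have "ts ! j \<in> W" using jk by (simp add: W_def k_def)
    ultimately show "map p ts ! j = us ! j"
      using j by (simp add: p_def g_def)
  qed
  ultimately show ?thesis using that by (auto simp: W_def)
qed

lemma pattern_at_permute_list:
  assumes "order_pattern k \<sigma>" "i + k \<le> length xs" "p permutes {i..<i+k}"
  shows "pattern_at \<sigma> i (permute_list p xs) \<longleftrightarrow>
    sorted_wrt (<) (map (\<lambda>j. xs ! p j) (map ((+) i) \<sigma>))"
proof -
  have p: "p permutes {..<length xs}"
    by (rule permutes_subset[OF assms(3)]) (use assms(2) in auto)
  have "map (\<lambda>j. permute_list p xs ! (i + j)) \<sigma> = map (\<lambda>j. xs ! p j) (map ((+) i) \<sigma>)"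
    unfolding map_map o_def
  proof (rule map_cong[OF refl])
    fix j assume "j \<in> set \<sigma>"
    then have "i + j < length xs" using assms(1,2) by (auto simp: order_pattern_def)
    with p show "permute_list p xs ! (i + j) = xs ! p (i + j)" by (rule permute_list_nth)
  qed
  then show ?thesis unfolding pattern_at_def by (rule arg_cong)
qed

text \<open>The values in the window, listed increasingly, sit at the positions \<open>us\<close>.
  The pattern holds exactly when \<open>p\<close> carries \<open>ts\<close> onto \<open>us\<close>,
  which determines \<open>p\<close>. Hence each pattern has probability \<open>1 / fact k\<close>
  under a uniform rearrangement.\<close>

lemma ex1_permutes_pattern_at:
  assumes \<sigma>: "order_pattern k \<sigma>" and xs: "distinct xs" and i: "i + k \<le> length xs"
  shows "\<exists>!p. p permutes {i..<i+k} \<and> pattern_at \<sigma> i (permute_list p xs)"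
proof -
  define W where "W = {i..<i+k}"
  define ts where "ts = map ((+) i) \<sigma>"
  have ts: "distinct ts" "set ts = W"
    using \<sigma> by (auto simp: ts_def W_def order_pattern_def distinct_map lessThan_atLeast0)
  have W: "W \<subseteq> {..<length xs}" "finite W" using i by (auto simp: W_def)
  have inj: "inj_on ((!) xs) W"
    by (rule inj_on_nth) (use xs W in auto)
  define L where "L = sorted_list_of_set ((!) xs ` W)"
  define us where "us = map (inv_into W ((!) xs)) L"
  have setL: "set L = (!) xs ` W" "distinct L" using W by (auto simp: L_def)
  have us: "set us = W" "distinct us" "map ((!) xs) us = L"
  proof -
    show "set us = W" using inj by (auto simp: us_def setL image_image inv_into_f_f)
    show "distinct us"
      unfolding us_def distinct_map using setL by (metis inj_on_inv_into order_refl)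
    show "map ((!) xs) us = L"
      unfolding us_def map_map o_def by (rule map_idI) (auto simp: setL f_inv_into_f)
  qed
  obtain p where p: "p permutes W" "map p ts = us"
    using permutes_mapping_list[OF ts(1) us(2)] ts us by metis
  have eq: "pattern_at \<sigma> i (permute_list q xs) \<longleftrightarrow> sorted_wrt (<) (map (\<lambda>j. xs ! q j) ts)"
    if "q permutes W" for q
    using pattern_at_permute_list[OF \<sigma> i] that unfolding ts_def W_def by blast
  show ?thesis unfolding W_def[symmetric]
  proof (rule ex1I[of _ p])
    have "map (\<lambda>j. xs ! p j) ts = map ((!) xs) (map p ts)" by simp
    also have "\<dots> = L" by (simp only: p us)
    finally show "p permutes W \<and> pattern_at \<sigma> i (permute_list p xs)"
      using p eq by (simp add: L_def)
  next
    fix q assume "q permutes W \<and> pattern_at \<sigma> i (permute_list q xs)"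
    then have q: "q permutes W" "sorted_wrt (<) (map (\<lambda>j. xs ! q j) ts)"
      using eq by auto
    have "set (map (\<lambda>j. xs ! q j) ts) = (!) xs ` W"
      using ts permutes_image[OF q(1)] by (metis image_image image_set)
    then have "map (\<lambda>j. xs ! q j) ts = L"
      using q(2) setL unfolding L_def
      by (metis strict_sorted_equal strict_sorted_list_of_set L_def)
    also have "\<dots> = map (\<lambda>j. xs ! p j) ts"
      using p us by (metis map_map o_def map_eq_conv)
    finally have "xs ! q j = xs ! p j" if "j \<in> W" for j
      using that ts by auto
    then have "q j = p j" if "j \<in> W" for j
      using that inj permutes_in_image[OF q(1)] permutes_in_image[OF p(1)]
      by (metis inj_on_def)
    then show "q = p"
      using p(1) q(1) by (metis ext permutes_not_in)
  qed
qed

section \<open>Deviations from the mean and their correlation\<close>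

definition pattern_dev :: "nat list set \<Rightarrow> nat \<Rightarrow> nat \<Rightarrow> 'a::linorder list \<Rightarrow> real" where
  "pattern_dev S k i xs = (\<Sum>\<sigma>\<in>S. of_bool (pattern_at \<sigma> i xs)) - real (card S) / fact k"

text \<open>Each pattern of \<open>S\<close> is realised by exactly one of the \<open>fact k\<close>
  rearrangements, so the counts add up to \<open>card S\<close>, and so do the subtracted
  means.\<close>

lemma sum_permutes_pattern_dev:
  assumes "finite S" "\<And>\<sigma>. \<sigma> \<in> S \<Longrightarrow> order_pattern k \<sigma>" "distinct xs" "i + k \<le> length xs"
  shows "(\<Sum>p | p permutes {i..<i+k}. pattern_dev S k i (permute_list p xs)) = 0"
proof -
  let ?P = "{p. p permutes {i..<i+k}}"
  have fin: "finite ?P" by (simp add: finite_permutations)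
  have one: "(\<Sum>p\<in>?P. of_bool (pattern_at \<sigma> i (permute_list p xs))) = (1::real)" if \<sigma>: "\<sigma> \<in> S" for \<sigma>
  proof -
    obtain q where q: "\<And>p. p permutes {i..<i+k} \<and> pattern_at \<sigma> i (permute_list p xs) \<longleftrightarrow> p = q"
      using ex1_permutes_pattern_at[OF assms(2) assms(3,4), OF \<sigma>] by (auto elim!: ex1E)
    have "?P \<inter> {p. pattern_at \<sigma> i (permute_list p xs)} = {q}" using q by auto
    then show ?thesis using fin by (simp add: sum_of_bool_eq)
  qed
  have "(\<Sum>p\<in>?P. \<Sum>\<sigma>\<in>S. of_bool (pattern_at \<sigma> i (permute_list p xs))) = real (card S)"
    by (subst sum.swap) (simp add: one)
  moreover have "card ?P = fact k" by (rule card_permutations) auto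
  ultimately show ?thesis by (simp add: pattern_dev_def sum_subtractf)
qed

lemma bij_betw_permute_list:
  assumes "p permutes {..<card A}" "finite A"
  shows "bij_betw (permute_list p) (permutations_of_set A) (permutations_of_set A)"
proof -
  have len: "length xs = card A" if "xs \<in> permutations_of_set A" for xs
    using that by (auto simp: permutations_of_set_def distinct_card)
  have q: "inv p permutes {..<card A}" by (rule permutes_inv[OF assms(1)])
  have mem: "permute_list r xs \<in> permutations_of_set A"
    if "r permutes {..<card A}" "xs \<in> permutations_of_set A" for r and xs :: "'a list"
    using that len[OF that(2)] by (auto simp: permutations_of_set_def)
  show ?thesis
  proof (rule bij_betwI[where g = "permute_list (inv p)"])
    show "permute_list (inv p) (permute_list p xs) = xs" if "xs \<in> permutations_of_set A" for xs
      using permute_list_compose[of "inv p" xs p] q len[OF that] permutes_inv_o[OF assms(1)]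
      by simp
    show "permute_list p (permute_list (inv p) xs) = xs" if "xs \<in> permutations_of_set A" for xs
      using permute_list_compose[of p xs "inv p"] assms(1) len[OF that] permutes_inv_o[OF assms(1)]
      by simp
  qed (use mem assms q in auto)
qed

text \<open>Rearranging the entries of the window is measure preserving, and averaging
  \<open>pattern_dev\<close> over all rearrangements gives \<open>0\<close>.\<close>

lemma sum_pattern_dev_mult_eq_0:
  assumes "finite S" "\<And>\<sigma>. \<sigma> \<in> S \<Longrightarrow> order_pattern k \<sigma>" "finite A" "i + k \<le> card A"
    and inv: "\<And>p xs. p permutes {i..<i+k} \<Longrightarrow> xs \<in> permutations_of_set A \<Longrightarrow> g (permute_list p xs) = g xs"
  shows "(\<Sum>xs\<in>permutations_of_set A. pattern_dev S k i xs * g xs) = (0::real)"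
proof -
  let ?O = "permutations_of_set A" and ?P = "{p. p permutes {i..<i+k}}"
  let ?T = "\<Sum>xs\<in>?O. pattern_dev S k i xs * g xs"
  have shift: "?T = (\<Sum>xs\<in>?O. pattern_dev S k i (permute_list p xs) * g xs)" if "p \<in> ?P" for p
  proof -
    have "p permutes {..<card A}"
      by (rule permutes_subset[of _ "{i..<i+k}"]) (use that assms(4) in auto)
    then have "?T = (\<Sum>xs\<in>?O. pattern_dev S k i (permute_list p xs) * g (permute_list p xs))"
      using bij_betw_permute_list[of p A] assms(3)
      by (intro sum.reindex_bij_betw[symmetric]) auto
    then show ?thesis using inv that by (simp cong: sum.cong)
  qed
  have "real (card ?P) * ?T = (\<Sum>p\<in>?P. \<Sum>xs\<in>?O. pattern_dev S k i (permute_list p xs) * g xs)"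
    by (subst sum_constant[symmetric], rule sum.cong[OF refl], rule shift)
  also have "\<dots> = (\<Sum>xs\<in>?O. (\<Sum>p\<in>?P. pattern_dev S k i (permute_list p xs)) * g xs)"
    by (subst sum.swap) (simp add: sum_distrib_right)
  also have "\<dots> = 0"
    using sum_permutes_pattern_dev[OF assms(1,2)] assms(4)
    by (intro sum.neutral ballI) (auto simp: permutations_of_set_def distinct_card)
  finally have "real (card ?P) * ?T = 0" .
  moreover have "card ?P = fact k" by (rule card_permutations) auto
  ultimately show ?thesis by simp
qed

text \<open>Rearranging the window at \<open>i\<close> leaves a disjoint window at \<open>j\<close>
  untouched, so the deviation at \<open>j\<close> serves as the invariant factor
  \<open>g\<close>.\<close>

lemma pattern_dev_uncorrelated:
  assumes "finite S" "\<And>\<sigma>. \<sigma> \<in> S \<Longrightarrow> order_pattern k \<sigma>" "finite A" "i + k \<le> card A" "j + k \<le> card A"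
    and disj: "i + k \<le> j \<or> j + k \<le> i"
  shows "(\<Sum>xs\<in>permutations_of_set A. pattern_dev S k i xs * pattern_dev S k j xs) = 0"
proof (rule sum_pattern_dev_mult_eq_0[OF assms(1,2,3,4)])
  fix p and xs :: "'a list"
  assume p: "p permutes {i..<i+k}" and xs: "xs \<in> permutations_of_set A"
  then have len: "length xs = card A" by (auto simp: permutations_of_set_def distinct_card)
  have p': "p permutes {..<length xs}"
    by (rule permutes_subset[OF p]) (use assms(4) len in auto)
  have "permute_list p xs ! (j + l) = xs ! (j + l)" if "l < k" for l
  proof -
    have "p (j + l) = j + l" by (rule permutes_not_in[OF p]) (use disj that in auto)
    moreover have "j + l < length xs" using that assms(5) len by simp
    ultimately show ?thesis using p' by (simp add: permute_list_nth)
  qed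
  then have "pattern_at \<sigma> j (permute_list p xs) = pattern_at \<sigma> j xs" if "\<sigma> \<in> S" for \<sigma>
    using assms(2)[OF that] unfolding pattern_at_def order_pattern_def
    by (metis (mono_tags, lifting) lessThan_iff map_cong)
  then show "pattern_dev S k j (permute_list p xs) = pattern_dev S k j xs"
    by (simp add: pattern_dev_def cong: sum.cong)
qed auto

section \<open>Second moment and tail bound\<close>

lemma abs_pattern_dev_le:
  assumes "finite S"
  shows "\<bar>pattern_dev S k i xs\<bar> \<le> real (card S)"
proof -
  have "0 \<le> (\<Sum>\<sigma>\<in>S. of_bool (pattern_at \<sigma> i xs) :: real)" by (intro sum_nonneg) auto
  moreover have "(\<Sum>\<sigma>\<in>S. of_bool (pattern_at \<sigma> i xs) :: real) \<le> (\<Sum>\<sigma>\<in>S. 1)"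
    by (intro sum_mono) auto
  moreover have "real (card S) / fact k \<le> real (card S)"
    by (simp add: divide_le_eq mult_left_le_one_le mult_le_cancel_left1)
  moreover have "0 \<le> real (card S) / fact k" by simp
  ultimately show ?thesis unfolding pattern_dev_def abs_le_iff by (simp only: sum_constant) linarith
qed

text \<open>Disjoint windows contribute nothing to the expanded square. For each \<open>i\<close> at
  most \<open>2 * k\<close> windows overlap its own, and their products are bounded trivially, so
  the average is only linear in \<open>card I\<close>.\<close>

lemma second_moment_pattern_dev:
  assumes "finite S" "\<And>\<sigma>. \<sigma> \<in> S \<Longrightarrow> order_pattern k \<sigma>" "finite A" "I \<subseteq> {i. i + k \<le> card A}" "finite I"
  shows "(\<Sum>xs\<in>permutations_of_set A. (\<Sum>i\<in>I. pattern_dev S k i xs)\<^sup>2)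
    \<le> 2 * real k * real (card S) ^ 2 * real (card I) * fact (card A)"
proof -
  let ?O = "permutations_of_set A"
  define c where "c i j = (\<Sum>xs\<in>?O. pattern_dev S k i xs * pattern_dev S k j xs)" for i j
  have cO: "card ?O = fact (card A)" using assms(3) by simp
  have c0: "c i j = 0" if "i \<in> I" "j \<in> I" "i + k \<le> j \<or> j + k \<le> i" for i j
    unfolding c_def by (intro pattern_dev_uncorrelated) (use assms that in auto)
  have c1: "c i j \<le> real (card S) ^ 2 * fact (card A)" for i j
  proof -
    have "c i j \<le> (\<Sum>xs\<in>?O. real (card S) * real (card S))" unfolding c_def
    proof (rule sum_mono)
      fix xs
      have "pattern_dev S k i xs * pattern_dev S k j xs \<le> \<bar>pattern_dev S k i xs\<bar> * \<bar>pattern_dev S k j xs\<bar>"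
        by (metis abs_ge_self abs_mult)
      also have "\<dots> \<le> real (card S) * real (card S)"
        by (intro mult_mono abs_pattern_dev_le assms) auto
      finally show "pattern_dev S k i xs * pattern_dev S k j xs \<le> real (card S) * real (card S)" .
    qed
    then show ?thesis using cO by (simp add: power2_eq_square mult.commute)
  qed
  have row: "(\<Sum>j\<in>I. c i j) \<le> 2 * real k * (real (card S) ^ 2 * fact (card A))" if "i \<in> I" for i
  proof -
    let ?J = "{j\<in>I. i < j + k \<and> j < i + k}"
    have "(\<Sum>j\<in>I. c i j) = (\<Sum>j\<in>?J. c i j)"
      using assms(5) c0[OF that] by (intro sum.mono_neutral_right) (auto simp flip: not_le)
    also have "\<dots> \<le> real (card ?J) * (real (card S) ^ 2 * fact (card A))"
      by (rule sum_bounded_above) (rule c1)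
    also have "card ?J \<le> card {i + 1 - k..<i + k}"
      by (rule card_mono) auto
    then have "real (card ?J) * (real (card S) ^ 2 * fact (card A))
        \<le> 2 * real k * (real (card S) ^ 2 * fact (card A))"
      by (intro mult_right_mono) auto
    finally show ?thesis .
  qed
  have "(\<Sum>xs\<in>?O. (\<Sum>i\<in>I. pattern_dev S k i xs)\<^sup>2) = (\<Sum>i\<in>I. \<Sum>j\<in>I. c i j)"
    unfolding c_def power2_eq_square sum_product
    by (subst sum.swap, rule sum.cong[OF refl], subst sum.swap) simp
  also have "\<dots> \<le> real (card I) * (2 * real k * (real (card S) ^ 2 * fact (card A)))"
    by (rule sum_bounded_above) (rule row)
  finally show ?thesis by (simp add: mult_ac)
qed

definition pattern_count :: "nat list set \<Rightarrow> nat set \<Rightarrow> 'a::linorder list \<Rightarrow> real" where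
  "pattern_count S I xs = (\<Sum>i\<in>I. \<Sum>\<sigma>\<in>S. of_bool (pattern_at \<sigma> i xs))"

text \<open>Chebyshev's inequality by counting: each permutation in the bad set contributes at least
  \<open>t^2\<close> to the second moment.\<close>

theorem pattern_count_concentration:
  assumes "finite S" "\<And>\<sigma>. \<sigma> \<in> S \<Longrightarrow> order_pattern k \<sigma>" "I \<subseteq> {i. i + k \<le> n}" "t > 0"
  shows "measure_pmf.prob (random_permutation n)
      {xs. t \<le> \<bar>pattern_count S I xs - real (card I) * (real (card S) / fact k)\<bar>}
    \<le> 2 * real k * real (card S) ^ 2 * real (card I) / t\<^sup>2"
proof -
  let ?O = "permutations_of_set {1..n}"
  let ?B = "{xs. t \<le> \<bar>pattern_count S I xs - real (card I) * (real (card S) / fact k)\<bar>}"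
  have "finite I" by (rule finite_subset[OF assms(3)]) (auto intro: finite_subset[of _ "{..n}"])
  have dev: "pattern_count S I xs - real (card I) * (real (card S) / fact k)
      = (\<Sum>i\<in>I. pattern_dev S k i xs)" for xs :: "nat list"
    by (simp add: pattern_count_def pattern_dev_def sum_subtractf)
  have "real (card (?O \<inter> ?B)) * t\<^sup>2 = (\<Sum>xs\<in>?O \<inter> ?B. t\<^sup>2)" by simp
  also have "\<dots> \<le> (\<Sum>xs\<in>?O \<inter> ?B. (\<Sum>i\<in>I. pattern_dev S k i xs)\<^sup>2)"
  proof (rule sum_mono)
    fix xs assume "xs \<in> ?O \<inter> ?B"
    then have "t \<le> \<bar>\<Sum>i\<in>I. pattern_dev S k i xs\<bar>"
      unfolding dev[symmetric] by simp
    then show "t\<^sup>2 \<le> (\<Sum>i\<in>I. pattern_dev S k i xs)\<^sup>2"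
      using assms(4) by (simp add: abs_le_square_iff[symmetric])
  qed
  also have "\<dots> \<le> (\<Sum>xs\<in>?O. (\<Sum>i\<in>I. pattern_dev S k i xs)\<^sup>2)"
    by (rule sum_mono2) auto
  also have "\<dots> \<le> 2 * real k * real (card S) ^ 2 * real (card I) * fact n"
    using second_moment_pattern_dev[of S k "{1..n}" I] assms \<open>finite I\<close> by simp
  finally have "real (card (?O \<inter> ?B)) / fact n \<le> 2 * real k * real (card S) ^ 2 * real (card I) / t\<^sup>2"
    using assms(4) by (simp add: field_simps)
  moreover have "measure_pmf.prob (random_permutation n) ?B = real (card (?O \<inter> ?B)) / fact n"
    unfolding random_permutation_def by (subst measure_pmf_of_set) auto
  ultimately show ?thesis by simp
qed

section \<open>The upper bound\<close>

lemma nths_conv_map_nth: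
  assumes "A \<subseteq> {..<length xs}"
  shows "nths xs A = map ((!) xs) (sorted_list_of_set A)"
proof -
  have "nths [0..<length xs] A = sorted_list_of_set A"
  proof (rule strict_sorted_equal)
    show "sorted_wrt (<) (nths [0..<length xs] A)"
      unfolding strict_sorted_iff by (simp add: sorted_nths)
    show "set (nths [0..<length xs] A) = set (sorted_list_of_set A)"
    proof -
      have "set (nths [0..<length xs] A) = A"
        unfolding set_nths using assms by auto (metis add_0 lessThan_iff nth_upt subsetD)
      then show ?thesis using finite_subset[OF assms finite_lessThan] by simp
    qed
  qed simp
  moreover have "nths xs A = map ((!) xs) (nths [0..<length xs] A)"
    by (simp add: nths_map[symmetric] map_nth)
  ultimately show ?thesis by simp
qed

text \<open>The first sign is left open, so that one predicate covers both alternating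
  shapes.\<close>

definition zigzag_on :: "(nat \<Rightarrow> 'a::linorder) \<Rightarrow> nat set \<Rightarrow> bool" where
  "zigzag_on x A \<longleftrightarrow> finite A \<and> (\<forall>j. j + 2 < card A \<longrightarrow>
     (x (sorted_list_of_set A ! j) < x (sorted_list_of_set A ! (j + 1))) \<noteq>
     (x (sorted_list_of_set A ! (j + 1)) < x (sorted_list_of_set A ! (j + 2))))"

text \<open>\<open>l\<close> and \<open>r\<close> are end positions: a run has \<open>r - l\<close>
  steps and the entries at \<open>{l..r}\<close>. With \<open>d\<close> false the steps are weakly
  descending.\<close>

definition run_on :: "(nat \<Rightarrow> 'a::linorder) \<Rightarrow> nat \<Rightarrow> nat \<Rightarrow> bool \<Rightarrow> bool" where
  "run_on x l r d \<longleftrightarrow> (\<forall>j\<in>{l..<r}. (x j < x (Suc j)) = d)"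

lemma run_on_less_iff:
  assumes "run_on x l r d" "l \<le> p" "p < q" "q \<le> r"
  shows "(x p < x q) = d"
  using assms(3,4)
proof (induction q)
  case (Suc q)
  have step: "(x q < x (Suc q)) = d"
    using assms(1,2) Suc.prems unfolding run_on_def by auto
  show ?case
  proof (cases "p = q")
    case False
    with Suc have "(x p < x q) = d" by auto
    with step show ?thesis by (cases d) auto
  qed (use step in simp)
qed simp

lemma sorted_list_of_set_nth_less:
  assumes "i < j" "j < card A"
  shows "sorted_list_of_set A ! i < sorted_list_of_set A ! j"
  by (rule sorted_wrt_nth_less[OF strict_sorted_list_of_set]) (use assms in auto)

text \<open>More than \<open>m\<close> indices point into the interval, so the least and the
  greatest of them differ by at least \<open>m\<close>; the index \<open>m\<close> after the least
  one cannot point beyond \<open>r\<close>.\<close>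

lemma interval_contains_consecutive:
  assumes "finite A" "m < card (A \<inter> {l..r})"
  obtains j where "j + m < card A" "l \<le> sorted_list_of_set A ! j" "sorted_list_of_set A ! (j + m) \<le> r"
proof -
  let ?L = "sorted_list_of_set A"
  define J where "J = {j. j < card A \<and> ?L ! j \<in> {l..r}}"
  have fin: "finite J" by (simp add: J_def)
  have "A \<inter> {l..r} \<subseteq> (!) ?L ` J"
  proof
    fix a assume a: "a \<in> A \<inter> {l..r}"
    then have "a \<in> set ?L" using assms(1) by simp
    then obtain j where "j < length ?L" "?L ! j = a" by (auto simp: in_set_conv_nth)
    then show "a \<in> (!) ?L ` J" using a by (auto simp: J_def)
  qed
  then have cJ: "m < card J"
    using assms(2) surj_card_le[OF fin] by (meson less_le_trans)
  then have ne: "J \<noteq> {}" by auto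
  have "J \<subseteq> {Min J..Max J}" using fin by auto
  then have "card J \<le> card {Min J..Max J}" by (rule card_mono[rotated]) simp
  with cJ have le: "Min J + m \<le> Max J" by simp
  have mem: "Min J \<in> J" "Max J \<in> J" using fin ne by auto
  then have "Min J + m < card A" using le by (auto simp: J_def)
  moreover have "?L ! (Min J + m) \<le> ?L ! Max J"
    using le mem sorted_list_of_set_nth_less[of "Min J + m" "Max J" A]
    by (cases "Min J + m = Max J") (auto simp: J_def)
  ultimately show ?thesis using that[of "Min J"] mem by (auto simp: J_def)
qed

text \<open>Three consecutive entries of the zigzag in one run would give two neighbouring steps of
  equal sign.\<close>

lemma card_zigzag_run_le:
  assumes "zigzag_on x A" "run_on x l r d"
  shows "card (A \<inter> {l..r}) \<le> 2"
proof (rule ccontr)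
  let ?L = "sorted_list_of_set A"
  assume "\<not> ?thesis"
  then obtain j where j: "j + 2 < card A" "l \<le> ?L ! j" "?L ! (j + 2) \<le> r"
    using interval_contains_consecutive[of A 2 l r] assms(1) by (auto simp: zigzag_on_def)
  have "?L ! j < ?L ! (j + 1)" "?L ! (j + 1) < ?L ! (j + 2)"
    using j by (auto intro!: sorted_list_of_set_nth_less)
  then have "(x (?L ! j) < x (?L ! (j + 1))) = d" "(x (?L ! (j + 1)) < x (?L ! (j + 2))) = d"
    using j by (intro run_on_less_iff[OF assms(2)]; linarith)+
  then show False using assms(1) j(1) unfolding zigzag_on_def by blast
qed

text \<open>Among four consecutive entries, steps one and three have one sign and step two the
  other. If the second entry is at most \<open>s\<close>, step one has sign \<open>d\<close>, and
  either step two lies in the first run or step three in the second; otherwise steps two and three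
  both lie in the second run.\<close>

lemma card_zigzag_two_runs_le:
  assumes "zigzag_on x A" "run_on x l s d" "run_on x s r (\<not> d)"
  shows "card (A \<inter> {l..r}) \<le> 3"
proof (rule ccontr)
  let ?L = "sorted_list_of_set A"
  assume "\<not> ?thesis"
  then obtain j where j: "j + 3 < card A" "l \<le> ?L ! j" "?L ! (j + 3) \<le> r"
    using interval_contains_consecutive[of A 3 l r] assms(1) by (auto simp: zigzag_on_def)
  define p where "p i = ?L ! (j + i)" for i
  have lt: "p 0 < p 1" "p 1 < p 2" "p 2 < p 3"
    using j by (auto simp: p_def intro!: sorted_list_of_set_nth_less)
  have lr: "l \<le> p 0" "p 3 \<le> r" using j by (auto simp: p_def)
  have z: "(x (p 0) < x (p 1)) \<noteq> (x (p 1) < x (p 2))" "(x (p 1) < x (p 2)) \<noteq> (x (p 2) < x (p 3))"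
    using assms(1) j(1) unfolding zigzag_on_def p_def
    by (auto simp: numeral_3_eq_3 numeral_2_eq_2 dest: spec[of _ j] spec[of _ "Suc j"])
  show False
  proof (cases "p 1 \<le> s")
    case True
    then have "(x (p 0) < x (p 1)) = d" using lt lr by (intro run_on_less_iff[OF assms(2)]) auto
    moreover have "(x (p 1) < x (p 2)) = d \<or> (x (p 2) < x (p 3)) = (\<not> d)"
    proof (cases "p 2 \<le> s")
      case True
      then show ?thesis using lt lr by (intro disjI1 run_on_less_iff[OF assms(2)]) auto
    next
      case False
      then show ?thesis using lt lr by (intro disjI2 run_on_less_iff[OF assms(3)]) auto
    qed
    ultimately show False using z by blast
  next
    case False
    then have "(x (p 1) < x (p 2)) = (\<not> d)" "(x (p 2) < x (p 3)) = (\<not> d)"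
      using lt lr by (intro run_on_less_iff[OF assms(3)]; linarith)+
    then show False using z by blast
  qed
qed

section \<open>Zigzag entries against monotone windows of length five\<close>

definition mono5_at :: "(nat \<Rightarrow> 'a::linorder) \<Rightarrow> nat \<Rightarrow> bool" where
  "mono5_at x i \<longleftrightarrow> (\<exists>d. run_on x i (i + 4) d)"

text \<open>Extend the step into \<open>e\<close> to the left as far as its sign \<open>d\<close>
  persists; minimality of \<open>s\<close> forces a change of sign there.\<close>

lemma maximal_run_ending_at:
  fixes x :: "nat \<Rightarrow> 'a::linorder"
  assumes "0 < e"
  obtains s d where "s < e" "run_on x s e d" "s = 0 \<or> (x (s - 1) < x s) = (\<not> d)"
proof -
  define d where "d = (x (e - 1) < x e)"
  define s where "s = (LEAST s. run_on x s e d)"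
  have ex: "run_on x (e - 1) e d" unfolding run_on_def
  proof
    fix j assume "j \<in> {e - 1..<e}"
    then have "j = e - 1" by auto
    then show "(x j < x (Suc j)) = d" using assms by (simp add: d_def)
  qed
  have s: "run_on x s e d" unfolding s_def by (rule LeastI[of "\<lambda>s. run_on x s e d"]) (rule ex)
  have "s \<le> e - 1" unfolding s_def by (rule Least_le[of "\<lambda>s. run_on x s e d"]) (rule ex)
  then have "s < e" using assms by simp
  moreover have "(x (s - 1) < x s) = (\<not> d)" if "0 < s"
  proof (rule ccontr)
    assume "(x (s - 1) < x s) \<noteq> (\<not> d)"
    then have "run_on x (s - 1) e d"
      using s that unfolding run_on_def
      by (metis Suc_pred' atLeastLessThan_iff le_less_Suc_eq not_le)
    then have "s \<le> s - 1" unfolding s_def by (rule Least_le)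
    with that show False by simp
  qed
  ultimately show ?thesis using that s by blast
qed

text \<open>A monotone window whose last position lies in the run beyond \<open>s\<close> cannot
  start before \<open>s\<close>, where the sign changes, so it starts in \<open>{s..<e - 3}\<close>.
  Truncated subtraction gives 0 for runs of at most three steps.\<close>

lemma card_mono5_within_run_le:
  assumes "s < e" "run_on x s e d" "s = 0 \<or> (x (s - 1) < x s) = (\<not> d)"
  shows "card {i. s < i + 4 \<and> i + 4 \<le> e \<and> mono5_at x i} \<le> e - s - 3"
proof -
  have "{i. s < i + 4 \<and> i + 4 \<le> e \<and> mono5_at x i} \<subseteq> {s..<e - 3}"
  proof
    fix i assume "i \<in> {i. s < i + 4 \<and> i + 4 \<le> e \<and> mono5_at x i}"
    then obtain c where i: "s < i + 4" "i + 4 \<le> e" "run_on x i (i + 4) c"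
      by (auto simp: mono5_at_def)
    have "s \<le> i"
    proof (rule ccontr)
      assume "\<not> s \<le> i"
      then have "s - 1 \<in> {i..<i+4}" "s \<in> {i..<i+4}" "0 < s" using i by auto
      then have "(x (s - 1) < x s) = c" "(x s < x (Suc s)) = c"
        using i(3) unfolding run_on_def by (metis Suc_pred', metis)
      moreover have "(x s < x (Suc s)) = d" using assms(1,2) by (auto simp: run_on_def)
      ultimately show False using assms(3) \<open>0 < s\<close> by auto
    qed
    then show "i \<in> {s..<e - 3}" using i by auto
  qed
  then have "card {i. s < i + 4 \<and> i + 4 \<le> e \<and> mono5_at x i} \<le> card {s..<e - 3}"
    by (rule card_mono[rotated]) simp
  then show ?thesis by simp
qed

text \<open>Peel the last maximal run off the prefix. A run carries at most two entries of each of the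
  two sequences; if the preceding run is long too, peel both, which carry at most three
  entries of each.\<close>

lemma zigzag_pair_prefix_bound:
  fixes x :: "nat \<Rightarrow> 'a::linorder"
  assumes A: "zigzag_on x A" and B: "zigzag_on x B" and disj: "A \<inter> B = {}"
  shows "card (A \<inter> {..<p}) + card (B \<inter> {..<p}) + card {i. i + 4 < p \<and> mono5_at x i} \<le> p"
proof (induction p rule: less_induct)
  case (less p)
  \<comment> \<open>\<open>U\<close> counts selected entries. \<open>W q r\<close> counts monotone
    windows by their last position, which must lie in \<open>{q..<r}\<close>, so that both can be
    split at a cut point.\<close>
  define U where "U X = card (A \<inter> X) + card (B \<inter> X)" for X
  define W where "W q r = card {i. q \<le> i + 4 \<and> i + 4 < r \<and> mono5_at x i}" for q r
  have IH: "U {..<q} + W 0 q \<le> q" if "q < p" for q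
    using less[OF that] by (simp add: U_def W_def)
  have U_card: "U X \<le> card X" if "finite X" for X
  proof -
    have "U X = card (A \<inter> X \<union> B \<inter> X)"
      unfolding U_def by (rule card_Un_disjoint[symmetric]) (use disj that in auto)
    also have "\<dots> \<le> card X" by (rule card_mono) (use that in auto)
    finally show ?thesis .
  qed
  have U_split: "U {..<r} \<le> U {..<q} + U {q..<r}" if "q \<le> r" for q r
  proof -
    have "C \<inter> {..<r} = (C \<inter> {..<q}) \<union> (C \<inter> {q..<r})" for C using that by auto
    then have "card (C \<inter> {..<r}) \<le> card (C \<inter> {..<q}) + card (C \<inter> {q..<r})" for C
      by (metis card_Un_le)
    from this[of A] this[of B] show ?thesis by (simp add: U_def)
  qed
  have W_split: "W q r \<le> W q m + W m r" for q m r
  proof -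
    have "{i. q \<le> i + 4 \<and> i + 4 < r \<and> mono5_at x i} \<subseteq>
      {i. q \<le> i + 4 \<and> i + 4 < m \<and> mono5_at x i} \<union> {i. m \<le> i + 4 \<and> i + 4 < r \<and> mono5_at x i}"
      by auto
    moreover have "finite {i. q' \<le> i + 4 \<and> i + 4 < r' \<and> mono5_at x i}" for q' r'
      by (rule finite_subset[of _ "{..<r'}"]) auto
    ultimately show ?thesis unfolding W_def
      by (intro order_trans[OF card_mono card_Un_le]) blast+
  qed
  have U_mono: "U X \<le> U Y" if "X \<subseteq> Y" for X Y
    unfolding U_def using A B that
    by (intro add_mono card_mono) (auto simp: zigzag_on_def)
  \<comment> \<open>It remains to choose a final block in which entries and windows together do not
    exceed its length.\<close>
  have step: "U {..<p} + W 0 p \<le> p" if "q < p" "U {q..<p} + W q p \<le> p - q" for q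
    using IH[OF that(1)] U_split[of q p] W_split[of 0 p q] that by simp
  have "U {..<p} + W 0 p \<le> p"
  proof (cases "p \<le> 1")
    case True
    then have "W 0 p = 0" by (auto simp: W_def)
    then show ?thesis using U_card[of "{..<p}"] by simp
  next
    case False
    define e where "e = p - 1"
    have p: "p = Suc e" "0 < e" using False by (auto simp: e_def)
    obtain s d where s: "s < e" "run_on x s e d" "s = 0 \<or> (x (s - 1) < x s) = (\<not> d)"
      using maximal_run_ending_at[OF p(2)] by metis
    have Ws: "W (Suc s) p \<le> e - s - 3"
      using card_mono5_within_run_le[OF s] by (simp add: W_def p Suc_le_eq less_Suc_eq_le)
    have U4: "U {s..<p} \<le> 4"
      using card_zigzag_run_le[OF A s(2)] card_zigzag_run_le[OF B s(2)]
      by (simp add: U_def p atLeastLessThanSuc_atLeastAtMost)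
    consider "e - s \<le> 3" | "e - s > 3" "s = 0" | "e - s > 3" "s > 0" by linarith
    then show ?thesis
    proof cases
      case 1
      \<comment> \<open>No monotone window ends in so short a run beyond \<open>s\<close>, and the
        trivial bound on entries suffices. The turning position \<open>s\<close> stays in the
        prefix.\<close>
      then show ?thesis
        using U_card[of "{Suc s..<p}"] Ws s(1) p by (intro step[of "Suc s"]) auto
    next
      case 2
      \<comment> \<open>The run is the whole prefix: at most four entries and \<open>e - 3\<close>
        windows, against \<open>e + 1\<close> positions.\<close>
      have "W 0 p \<le> W 0 1 + W 1 p" by (rule W_split)
      moreover have "W 0 1 = 0" by (simp add: W_def)
      ultimately have "W 0 p \<le> e - 3" using Ws 2 by simp
      moreover have "{..<p} = {s..<p}" using 2 by auto
      ultimately show ?thesis using U4 2 p by simp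
    next
      case 3
      obtain s' d' where s': "s' < s" "run_on x s' s d'" "s' = 0 \<or> (x (s' - 1) < x s') = (\<not> d')"
        using maximal_run_ending_at[OF 3(2)] by metis
      have "(x (s - 1) < x s) = d'"
        using s'(1,2) unfolding run_on_def by (metis Suc_pred' 3(2) atLeastLessThan_iff diff_less
          less_Suc_eq_le zero_less_one)
      with s(3) 3 have d': "d = (\<not> d')" by auto
      have Ws': "W (Suc s') (Suc s) \<le> s - s' - 3"
        using card_mono5_within_run_le[OF s'] by (simp add: W_def Suc_le_eq less_Suc_eq_le)
      show ?thesis
      proof (cases "s - s' \<le> 3")
        case True
        \<comment> \<open>The preceding run is too short for a window to end at \<open>s\<close>, so
          \<open>s\<close> is peeled off too: at most four entries and \<open>e - s - 3\<close>
          windows in a block of length \<open>e - s + 1\<close>.\<close>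
        have "W s p \<le> W s (Suc s) + W (Suc s) p" by (rule W_split)
        moreover have "W s (Suc s) \<le> W (Suc s') (Suc s)" unfolding W_def
          by (rule card_mono) (use s'(1) in \<open>auto intro: finite_subset[of _ "{..<Suc s}"]\<close>)
        ultimately have "W s p \<le> e - s - 3" using Ws Ws' True by simp
        then show ?thesis using U4 3 p s(1) by (intro step[of s]) auto
      next
        case False
        \<comment> \<open>Two long runs: at most six entries and \<open>e - s' - 6\<close> windows
          in a block of length \<open>e - s'\<close>. Bounding the runs separately would only give
          eight entries.\<close>
        have "U {Suc s'..<p} \<le> U {s'..e}" by (rule U_mono) (auto simp: p)
        also have "\<dots> \<le> 6"
          using card_zigzag_two_runs_le[OF A s'(2), of e] card_zigzag_two_runs_le[OF B s'(2), of e] s(2) d'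
          by (simp add: U_def)
        finally have "U {Suc s'..<p} \<le> 6" .
        moreover have "W (Suc s') p \<le> (s - s' - 3) + (e - s - 3)"
          using W_split[of "Suc s'" p "Suc s"] Ws Ws' by simp
        ultimately show ?thesis
          using False 3 p s(1) s'(1) by (intro step[of "Suc s'"]) auto
      qed
    qed
  qed
  then show ?case by (simp add: U_def W_def)
qed

section \<open>Twins as disjoint zigzag sets\<close>

lemma zigzag_on_if_alternating_shape:
  assumes A: "A \<subseteq> {..<length xs}" and "shape (nths xs A) \<in> alternating_shapes (length (nths xs A) - 1)"
  shows "zigzag_on ((!) xs) A"
proof -
  let ?L = "sorted_list_of_set A"
  have fin: "finite A" using A finite_subset by blast
  have zs: "nths xs A = map ((!) xs) ?L" by (rule nths_conv_map_nth[OF A])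
  have len: "length (nths xs A) = card A" by (simp add: zs)
  have "(xs ! (?L ! j) < xs ! (?L ! (j + 1))) \<noteq> (xs ! (?L ! (j + 1)) < xs ! (?L ! (j + 2)))"
    if j: "j + 2 < card A" for j
  proof -
    have nth: "shape (nths xs A) ! i = (xs ! (?L ! i) < xs ! (?L ! (i + 1)))" if "i + 1 < card A" for i
      using that by (simp add: shape_def len) (simp add: zs)
    from assms(2) consider "shape (nths xs A) = map even [0..<card A - 1]"
      | "shape (nths xs A) = map odd [0..<card A - 1]"
      by (auto simp: alternating_shapes_def len)
    then show ?thesis
      using nth[of j] nth[of "j + 1"] j by cases auto
  qed
  then show ?thesis using fin by (simp add: zigzag_on_def)
qed

theorem alpha_upper_bound:
  "2 * alpha xs + card {i. i + 4 < length xs \<and> mono5_at ((!) xs) i} \<le> length xs"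
proof -
  have "alpha xs \<in> alternating_twin_lengths xs"
    unfolding alpha_def using finite_alternating_twin_lengths zero_mem_alternating_twin_lengths
    by (metis Max_in empty_iff)
  then obtain A B where AB: "alternating_twins xs (alpha xs) A B"
    by (auto simp: alternating_twin_lengths_def)
  then have sub: "A \<subseteq> {..<length xs}" "B \<subseteq> {..<length xs}" by (auto simp: alternating_twins_def)
  have "zigzag_on ((!) xs) A" "zigzag_on ((!) xs) B"
    using AB by (auto simp: alternating_twins_def intro!: zigzag_on_if_alternating_shape)
  moreover have "card A = alpha xs" "card B = alpha xs"
    using AB by (auto simp: alternating_twins_def nths_conv_map_nth)
  moreover have "A \<inter> {..<length xs} = A" "B \<inter> {..<length xs} = B" using sub by auto
  moreover have "A \<inter> B = {}" using AB by (auto simp: alternating_twins_def)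
  ultimately show ?thesis
    using zigzag_pair_prefix_bound[of "(!) xs" A B "length xs"] by simp
qed

section \<open>The lower bound\<close>

fun zigzag :: "bool \<Rightarrow> 'a::linorder list \<Rightarrow> bool" where
  "zigzag d (x # y # r) \<longleftrightarrow> (x < y) = d \<and> zigzag (\<not> d) (y # r)"
| "zigzag d _ \<longleftrightarrow> True"

fun turns :: "'a::linorder list \<Rightarrow> nat" where
  "turns (x # y # z # r) = of_bool ((x < y) \<noteq> (y < z)) + turns (y # z # r)"
| "turns _ = 0"

lemma zigzag_take: "zigzag d ys \<Longrightarrow> zigzag d (take w ys)"
proof (induction d ys arbitrary: w rule: zigzag.induct)
  case (1 d x y r)
  show ?case
  proof (cases w)
    case (Suc v)
    with 1 show ?thesis using "1.IH"[of "Suc (v - 1)"] by (cases v) auto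
  qed simp
qed (auto simp: take_Cons split: nat.split)

lemma zigzag_nth:
  "zigzag d ys \<Longrightarrow> Suc i < length ys \<Longrightarrow> (ys ! i < ys ! Suc i) = (even i = d)"
proof (induction d ys arbitrary: i rule: zigzag.induct)
  case (1 d x y r)
  then show ?case by (cases i) auto
qed auto

lemma shape_zigzag:
  assumes "zigzag True ys"
  shows "shape ys = map even [0..<length ys - 1]"
  unfolding shape_def by (rule map_cong) (use zigzag_nth[OF assms] in auto)

text \<open>Keep \<open>y\<close> at a turn; elsewhere skip it, since by transitivity the step from
  \<open>x\<close> to the next selected entry has the direction of the step from \<open>x\<close> to
  \<open>y\<close>. Prescribing the first entry \<open>x\<close> makes the induction work.\<close>

lemma zigzag_subseq_turns_aux:
  "\<exists>ys. subseq (x # ys) (x # y # r) \<and> zigzag (x < y) (x # ys) \<and> length ys = Suc (turns (x # y # r))"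
proof (induction r arbitrary: x y)
  case Nil
  show ?case by (rule exI[of _ "[y]"]) auto
next
  case (Cons z r)
  from Cons.IH[of y z] obtain ys where ys: "subseq (y # ys) (y # z # r)" "zigzag (y < z) (y # ys)"
    "length ys = Suc (turns (y # z # r))" by blast
  show ?case
  proof (cases "(x < y) = (y < z)")
    case False
    then have "zigzag (x < y) (x # y # ys)" using ys(2) by simp
    with ys False show ?thesis by (intro exI[of _ "y # ys"]) auto
  next
    case True
    obtain u v where uv: "ys = u # v" using ys(3) by (cases ys) auto
    have "(y < u) = (y < z)" using ys(2) by (simp add: uv)
    with True have "(x < u) = (x < y)" by auto
    then have "zigzag (x < y) (x # ys)" using ys(2) True by (simp add: uv)
    with ys True show ?thesis by (intro exI[of _ ys]) auto
  qed
qed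

text \<open>Twins need equal shapes, so the subsequence is made to start with an ascent by dropping
  its first entry if necessary, and then cut to length \<open>w\<close>. The auxiliary lemma yields
  two entries more than \<open>turns zs\<close>, which leaves room for this.\<close>

lemma zigzag_subseq_turns:
  assumes "w \<le> turns zs"
  obtains ys where "subseq ys zs" "zigzag True ys" "length ys = w"
proof (cases "w = 0")
  case True
  then show ?thesis using that[of "[]"] by simp
next
  case False
  then obtain x y r where zs: "zs = x # y # r"
    using assms by (cases zs rule: turns.cases) auto
  obtain ys where ys: "subseq (x # ys) zs" "zigzag (x < y) (x # ys)" "length ys = Suc (turns zs)"
    using zigzag_subseq_turns_aux[of x y r] unfolding zs by blast
  obtain us where us: "subseq us zs" "zigzag True us" "w \<le> length us"
  proof (cases "x < y")
    case True
    then show ?thesis using that[of "x # ys"] ys assms by simp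
  next
    case False
    have "subseq ys zs" using ys(1) by (rule subseq_Cons')
    moreover have "zigzag True ys" using ys(2,3) False by (cases ys) auto
    ultimately show ?thesis using that[of ys] ys(3) assms by simp
  qed
  have "subseq (take w us) zs"
    using us(1) by (metis append_take_drop_id list_emb_append2 subseq_order.trans subseq_rev_drop_many subseq_order.refl)
  then show ?thesis using that[of "take w us"] us zigzag_take[of True us w] by simp
qed

lemma alpha_ge_turns:
  assumes "A \<subseteq> {..<length xs}" "B \<subseteq> {..<length xs}" "A \<inter> B = {}"
    "w \<le> turns (nths xs A)" "w \<le> turns (nths xs B)"
  shows "w \<le> alpha xs"
proof -
  have *: "\<exists>C'\<subseteq>C. shape (nths xs C') = map even [0..<w - 1] \<and> length (nths xs C') = w"
    if w: "w \<le> turns (nths xs C)" for C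
  proof -
    obtain ys where ys: "subseq ys (nths xs C)" "zigzag True ys" "length ys = w"
      using zigzag_subseq_turns[OF w] by blast
    then obtain N where N: "ys = nths (nths xs C) N" by (auto simp: subseq_conv_nths)
    \<comment> \<open>Pulls the indices \<open>N\<close> in the sublist back to positions in
      \<open>xs\<close>: the rank of \<open>i\<close> inside \<open>C\<close> must belong to
      \<open>N\<close>.\<close>
    define C' where "C' = {i \<in> C. \<exists>j\<in>N. card {i' \<in> C. i' < i} = j}"
    have "ys = nths xs C'" unfolding N C'_def by (rule nths_nths)
    moreover have "C' \<subseteq> C" by (auto simp: C'_def)
    ultimately show ?thesis using shape_zigzag[OF ys(2)] ys(3) by blast
  qed
  obtain A' where A': "A' \<subseteq> A" "shape (nths xs A') = map even [0..<w - 1]" "length (nths xs A') = w"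
    using *[OF assms(4)] by blast
  obtain B' where B': "B' \<subseteq> B" "shape (nths xs B') = map even [0..<w - 1]" "length (nths xs B') = w"
    using *[OF assms(5)] by blast
  have "alternating_twins xs w A' B'"
    unfolding alternating_twins_def using A' B' assms by (auto simp: alternating_shapes_def)
  then have "w \<in> alternating_twin_lengths xs" by (auto simp: alternating_twin_lengths_def)
  then show ?thesis unfolding alpha_def by (intro Max_ge finite_alternating_twin_lengths)
qed

lemma turns_conv_sum:
  "turns zs = (\<Sum>j<length zs - 2. of_bool ((zs ! j < zs ! Suc j) \<noteq> (zs ! Suc j < zs ! Suc (Suc j))))"
  by (induction zs rule: turns.induct) (simp_all add: sum.lessThan_Suc_shift del: sum_of_bool_eq sum.lessThan_Suc)

section \<open>Detecting turns locally\<close>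

definition consecutive_in :: "nat set \<Rightarrow> nat \<Rightarrow> nat \<Rightarrow> bool" where
  "consecutive_in A p q \<longleftrightarrow> p \<in> A \<and> q \<in> A \<and> p < q \<and> A \<inter> {p<..<q} = {}"

lemma consecutive_in_nth:
  assumes "finite A" "consecutive_in A p q"
  obtains j where "Suc j < card A" "sorted_list_of_set A ! j = p" "sorted_list_of_set A ! Suc j = q"
proof -
  let ?L = "sorted_list_of_set A"
  have "p \<in> set ?L" "q \<in> set ?L" using assms by (auto simp: consecutive_in_def)
  then obtain a b where ab: "a < card A" "?L ! a = p" "b < card A" "?L ! b = q"
    by (auto simp: in_set_conv_nth)
  have "p < q" using assms(2) by (simp add: consecutive_in_def)
  then have "a < b"
    using ab sorted_list_of_set_nth_less[of b a A] by (metis less_asym linorder_neqE_nat)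
  moreover have "b \<le> Suc a"
  proof (rule ccontr)
    assume "\<not> b \<le> Suc a"
    then have "?L ! Suc a \<in> {p<..<q}" using ab by (auto intro!: sorted_list_of_set_nth_less)
    moreover have "?L ! Suc a \<in> set ?L" using ab \<open>\<not> b \<le> Suc a\<close> by (intro nth_mem) simp
    ultimately show False using assms by (auto simp: consecutive_in_def)
  qed
  ultimately have "b = Suc a" by simp
  then show ?thesis using that ab by blast
qed

text \<open>Turns are certified one entry at a time: each \<open>q\<close> in \<open>M\<close>, with
  its two neighbours in \<open>A\<close>, comes from an index of the sorted list at which a turn
  occurs, and distinct \<open>q\<close> need distinct indices.\<close>

lemma card_le_turns:
  fixes x :: "nat \<Rightarrow> 'a::linorder"
  assumes "finite A"
    and M: "\<And>q. q \<in> M \<Longrightarrow> \<exists>p r. consecutive_in A p q \<and> consecutive_in A q r \<and> (x p < x q) \<noteq> (x q < x r)"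
  shows "card M \<le> turns (map x (sorted_list_of_set A))"
proof -
  let ?L = "sorted_list_of_set A"
  define J where "J = {j. j < card A - 2 \<and> (x (?L ! j) < x (?L ! Suc j)) \<noteq> (x (?L ! Suc j) < x (?L ! Suc (Suc j)))}"
  have "M \<subseteq> (\<lambda>j. ?L ! Suc j) ` J"
  proof
    fix q assume "q \<in> M"
    then obtain p r where pr: "consecutive_in A p q" "consecutive_in A q r" "(x p < x q) \<noteq> (x q < x r)"
      using M by blast
    obtain a where a: "Suc a < card A" "?L ! a = p" "?L ! Suc a = q"
      using consecutive_in_nth[OF assms(1) pr(1)] by blast
    obtain b where b: "Suc b < card A" "?L ! b = q" "?L ! Suc b = r"
      using consecutive_in_nth[OF assms(1) pr(2)] by blast
    have "b = Suc a" using a b by (metis Suc_lessD distinct_sorted_list_of_set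
          length_sorted_list_of_set nth_eq_iff_index_eq)
    then have "a \<in> J" using a b pr(3) by (auto simp: J_def)
    then show "q \<in> (\<lambda>j. ?L ! Suc j) ` J" using a by blast
  qed
  moreover have "finite J" by (simp add: J_def)
  ultimately have "card M \<le> card J" by (rule surj_card_le[rotated])
  also have "card J = (\<Sum>j<card A - 2. of_bool ((x (?L ! j) < x (?L ! Suc j)) \<noteq> (x (?L ! Suc j) < x (?L ! Suc (Suc j)))))"
    by (subst sum_of_bool_eq) (auto simp: J_def intro!: arg_cong[where f = card])
  also have "\<dots> = turns (map x ?L)"
    unfolding turns_conv_sum by (intro sum.cong) auto
  finally show ?thesis .
qed

section \<open>Local extrema and non-extrema\<close>

definition extrema :: "(nat \<Rightarrow> 'a::linorder) \<Rightarrow> nat \<Rightarrow> nat set" where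
  "extrema x n = {q. 0 < q \<and> Suc q < n \<and> (x (q - 1) < x q) \<noteq> (x q < x (Suc q))}"

definition non_extrema :: "(nat \<Rightarrow> 'a::linorder) \<Rightarrow> nat \<Rightarrow> nat set" where
  "non_extrema x n = {q. 0 < q \<and> Suc q < n \<and> (x (q - 1) < x q) = (x q < x (Suc q))}"

text \<open>The step sign changes only at an extremum, so the sign found at \<open>p\<close>
  persists up to \<open>q\<close>.\<close>

lemma run_between_extrema:
  assumes "extrema x n \<inter> {p<..<q} = {}" "q < n"
  shows "run_on x p q (x p < x (Suc p))"
proof -
  have "(x j < x (Suc j)) = (x p < x (Suc p))" if "p \<le> j" "j < q" for j
    using that
  proof (induction j rule: dec_induct)
    case (step j)
    then have "Suc j \<notin> extrema x n" using assms(1) by auto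
    with step assms(2) show ?case by (auto simp: extrema_def)
  qed simp
  then show ?thesis unfolding run_on_def by (meson atLeastLessThan_iff)
qed

text \<open>Steps between consecutive extrema share one sign, so comparing \<open>q\<close> with the
  neighbouring extrema gives the same signs as comparing it with the adjacent positions, and those
  differ.\<close>

lemma turn_at_extremum:
  assumes "consecutive_in (extrema x n) p q" "consecutive_in (extrema x n) q r"
  shows "(x p < x q) \<noteq> (x q < x r)"
proof -
  have pq: "p < q" "q < r" "r < n" "0 < q" and q: "(x (q - 1) < x q) \<noteq> (x q < x (Suc q))"
    using assms by (auto simp: consecutive_in_def extrema_def)
  have run: "run_on x p q (x p < x (Suc p))" "run_on x q r (x q < x (Suc q))"
    using assms pq by (auto simp: consecutive_in_def intro!: run_between_extrema[of x n])
  have "(x p < x q) = (x p < x (Suc p))" "(x q < x r) = (x q < x (Suc q))"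
    by (rule run_on_less_iff[OF run(1) order_refl pq(1) order_refl]
        run_on_less_iff[OF run(2) order_refl pq(2) order_refl])+
  moreover have "(x (q - 1) < x q) = (x p < x (Suc p))"
    by (rule run_on_less_iff[OF run(1)]) (use pq in auto)
  ultimately show ?thesis using q by blast
qed

lemma consecutive_in_neighbours:
  assumes "finite F" "q \<in> F" "q \<noteq> Min F" "q \<noteq> Max F"
  obtains p r where "consecutive_in F p q" "consecutive_in F q r"
proof -
  have "Min F < q" "q < Max F"
    using assms Min_le[of F q] Max_ge[of F q] by linarith+
  moreover have "Min F \<in> F" "Max F \<in> F" using assms by (auto intro: Min_in Max_in)
  ultimately have ne: "F \<inter> {..<q} \<noteq> {}" "F \<inter> {q<..} \<noteq> {}" by auto
  have fin: "finite (F \<inter> {..<q})" "finite (F \<inter> {q<..})" using assms(1) by auto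
  have "consecutive_in F (Max (F \<inter> {..<q})) q"
    using Max_in[OF fin(1) ne(1)] Max_ge[OF fin(1)] assms(2)
    by (auto simp: consecutive_in_def simp flip: not_le)
  moreover have "consecutive_in F q (Min (F \<inter> {q<..}))"
    using Min_in[OF fin(2) ne(2)] Min_le[OF fin(2)] assms(2)
    by (auto simp: consecutive_in_def simp flip: not_le)
  ultimately show ?thesis using that by blast
qed

text \<open>Windows of six entries whose two largest (smallest) entries are the middle ones, with the
  values increasing (decreasing) before and decreasing (increasing) after them. The more extreme of
  the two is the only local extremum inside the window, so the other one is a local extremum of the
  sequence of non-extrema.\<close>

definition peak_left :: "(nat \<Rightarrow> 'a::linorder) \<Rightarrow> nat \<Rightarrow> bool" where
  "peak_left x i \<longleftrightarrow> x i < x (i+1) \<and> x (i+1) < x (i+2) \<and> x (i+2) < x (i+3) \<and>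
     x (i+5) < x (i+4) \<and> x (i+4) < x (i+2)"

definition peak_right :: "(nat \<Rightarrow> 'a::linorder) \<Rightarrow> nat \<Rightarrow> bool" where
  "peak_right x i \<longleftrightarrow> x i < x (i+1) \<and> x (i+1) < x (i+3) \<and> x (i+3) < x (i+2) \<and>
     x (i+5) < x (i+4) \<and> x (i+4) < x (i+3)"

definition valley_left :: "(nat \<Rightarrow> 'a::linorder) \<Rightarrow> nat \<Rightarrow> bool" where
  "valley_left x i \<longleftrightarrow> x i > x (i+1) \<and> x (i+1) > x (i+2) \<and> x (i+2) > x (i+3) \<and>
     x (i+5) > x (i+4) \<and> x (i+4) > x (i+2)"

definition valley_right :: "(nat \<Rightarrow> 'a::linorder) \<Rightarrow> nat \<Rightarrow> bool" where
  "valley_right x i \<longleftrightarrow> x i > x (i+1) \<and> x (i+1) > x (i+3) \<and> x (i+3) > x (i+2) \<and>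
     x (i+5) > x (i+4) \<and> x (i+4) > x (i+3)"

text \<open>The sign \<open>d\<close> lets peaks and valleys be treated together. The last equation
  compares the two neighbours of the extremum at \<open>i + 3\<close>, which become adjacent once it
  is removed.\<close>

lemma left_window_steps:
  assumes "peak_left x i \<or> valley_left x i"
  obtains d where "(x i < x (i+1)) = d" "(x (i+1) < x (i+2)) = d" "(x (i+2) < x (i+3)) = d"
    "(x (i+3) < x (i+4)) = (\<not> d)" "(x (i+4) < x (i+5)) = (\<not> d)" "(x (i+2) < x (i+4)) = (\<not> d)"
  using assms
proof
  assume "peak_left x i"
  note w = this[unfolded peak_left_def]
  show ?thesis by (rule that[of True]) (use w in auto)
next
  assume "valley_left x i"
  note w = this[unfolded valley_left_def]
  show ?thesis by (rule that[of False]) (use w in auto)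
qed

lemma right_window_steps:
  assumes "peak_right x i \<or> valley_right x i"
  obtains d where "(x i < x (i+1)) = d" "(x (i+1) < x (i+2)) = d" "(x (i+2) < x (i+3)) = (\<not> d)"
    "(x (i+3) < x (i+4)) = (\<not> d)" "(x (i+4) < x (i+5)) = (\<not> d)" "(x (i+1) < x (i+3)) = d"
  using assms
proof
  assume "peak_right x i"
  note w = this[unfolded peak_right_def]
  show ?thesis by (rule that[of True]) (use w in auto)
next
  assume "valley_right x i"
  note w = this[unfolded valley_right_def]
  show ?thesis by (rule that[of False]) (use w in auto)
qed

text \<open>With the extremum at \<open>i + 3\<close> removed, \<open>i + 2\<close> stands between
  \<open>i + 1\<close> and \<open>i + 4\<close> and forms a turn.\<close>

lemma left_window_non_extrema:
  assumes "peak_left x i \<or> valley_left x i" "i + 5 < n"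
  shows "{i+1, i+2, i+4} \<subseteq> non_extrema x n" "i + 3 \<notin> non_extrema x n"
    "(x (i+1) < x (i+2)) \<noteq> (x (i+2) < x (i+4))"
proof -
  obtain d where "(x i < x (i+1)) = d" "(x (i+1) < x (i+2)) = d"
    "(x (i+2) < x (i+3)) = d" "(x (i+3) < x (i+4)) = (\<not> d)"
    "(x (i+4) < x (i+5)) = (\<not> d)" "(x (i+2) < x (i+4)) = (\<not> d)"
    using left_window_steps[OF assms(1)] by metis
  note d = this
  note defs = non_extrema_def eval_nat_numeral
  show "{i+1, i+2, i+4} \<subseteq> non_extrema x n" using assms(2) d by (cases d) (simp_all add: defs)
  show "i + 3 \<notin> non_extrema x n" using d by (cases d) (simp_all add: defs)
  show "(x (i+1) < x (i+2)) \<noteq> (x (i+2) < x (i+4))" using d by (cases d) (simp_all add: defs)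
qed

text \<open>The mirror image: the extremum is at \<open>i + 2\<close>, and \<open>i + 3\<close>
  becomes the turn.\<close>

lemma right_window_non_extrema:
  assumes "peak_right x i \<or> valley_right x i" "i + 5 < n"
  shows "{i+1, i+3, i+4} \<subseteq> non_extrema x n" "i + 2 \<notin> non_extrema x n"
    "(x (i+1) < x (i+3)) \<noteq> (x (i+3) < x (i+4))"
proof -
  obtain d where "(x i < x (i+1)) = d" "(x (i+1) < x (i+2)) = d"
    "(x (i+2) < x (i+3)) = (\<not> d)" "(x (i+3) < x (i+4)) = (\<not> d)"
    "(x (i+4) < x (i+5)) = (\<not> d)" "(x (i+1) < x (i+3)) = d"
    using right_window_steps[OF assms(1)] by metis
  note d = this
  note defs = non_extrema_def eval_nat_numeral
  show "{i+1, i+3, i+4} \<subseteq> non_extrema x n" using assms(2) d by (cases d) (simp_all add: defs)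
  show "i + 2 \<notin> non_extrema x n" using d by (cases d) (simp_all add: defs)
  show "(x (i+1) < x (i+3)) \<noteq> (x (i+3) < x (i+4))" using d by (cases d) (simp_all add: defs)
qed

text \<open>These two windows would claim the same turn at \<open>i + 3\<close>. The right one has
  its extremum at \<open>i + 2\<close>, where the left one is monotone.\<close>

lemma left_right_windows_disjoint:
  assumes "peak_left x (i+1) \<or> valley_left x (i+1)" "peak_right x i \<or> valley_right x i"
  shows False
proof -
  obtain c where "(x (i+1+1) < x (i+1+2)) = c" "(x (i+1) < x (i+1+1)) = c"
    using left_window_steps[OF assms(1)] by metis
  moreover obtain d where "(x (i+1) < x (i+2)) = d" "(x (i+2) < x (i+3)) = (\<not> d)"
    using right_window_steps[OF assms(2)] by metis
  ultimately show False by (simp add: eval_nat_numeral)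
qed

text \<open>\<open>X\<close> and \<open>Y\<close> are disjoint intervals, so neighbours inside one
  of them stay neighbours in \<open>C\<close>. All extrema in \<open>X\<close> except possibly the
  first and last are turns, which costs 2, and each counted window in \<open>Y\<close> adds its own
  turn.\<close>

lemma turns_extrema_non_extrema:
  fixes x :: "nat \<Rightarrow> 'a::linorder"
  assumes X: "X = {a..<b}" and Y: "Y = {c..<d}" and XY: "X \<inter> Y = {}" "d \<le> n"
    and C: "C = extrema x n \<inter> X \<union> non_extrema x n \<inter> Y"
  shows "card (extrema x n \<inter> X) + card {i. c \<le> i \<and> i + 5 < d \<and> (peak_left x i \<or> valley_left x i)}
    + card {i. c \<le> i \<and> i + 5 < d \<and> (peak_right x i \<or> valley_right x i)}
    \<le> turns (map x (sorted_list_of_set C)) + 2"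
proof -
  let ?E = "extrema x n" and ?N = "non_extrema x n"
  define I J where "I = {i. c \<le> i \<and> i + 5 < d \<and> (peak_left x i \<or> valley_left x i)}"
    and "J = {i. c \<le> i \<and> i + 5 < d \<and> (peak_right x i \<or> valley_right x i)}"
  define F where "F = ?E \<inter> X"
  have "I \<subseteq> {..<d}" "J \<subseteq> {..<d}" by (auto simp: I_def J_def)
  then have finIJ: "finite I" "finite J" by (auto intro: finite_subset)
  have finF: "finite F" and finC: "finite C" by (auto simp: F_def C X Y)
  have EN: "?E \<inter> ?N = {}" by (auto simp: extrema_def non_extrema_def)
  \<comment> \<open>The first and last extremum in \<open>X\<close> may lack a neighbour within
    \<open>X\<close>. If \<open>F\<close> is empty, so is \<open>M1\<close>, whatever
    \<open>Min F\<close> and \<open>Max F\<close> are.\<close>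
  define M1 where "M1 = F - {Min F, Max F}"
  define M2 where "M2 = (\<lambda>i. i + 2) ` I \<union> (\<lambda>i. i + 3) ` J"
  have left: "{i+1, i+2, i+4} \<subseteq> ?N \<inter> Y" "i + 3 \<notin> ?N" "(x (i+1) < x (i+2)) \<noteq> (x (i+2) < x (i+4))"
    if "i \<in> I" for i
  proof -
    have i: "peak_left x i \<or> valley_left x i" "i + 5 < n" "c \<le> i" "i + 5 < d"
      using that XY(2) by (auto simp: I_def)
    note w = left_window_non_extrema[OF i(1,2)]
    show "{i+1, i+2, i+4} \<subseteq> ?N \<inter> Y" using w(1) i(3,4) by (simp add: Y)
    show "i + 3 \<notin> ?N" by (rule w(2))
    show "(x (i+1) < x (i+2)) \<noteq> (x (i+2) < x (i+4))" by (rule w(3))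
  qed
  have right: "{i+1, i+3, i+4} \<subseteq> ?N \<inter> Y" "i + 2 \<notin> ?N" "(x (i+1) < x (i+3)) \<noteq> (x (i+3) < x (i+4))"
    if "i \<in> J" for i
  proof -
    have i: "peak_right x i \<or> valley_right x i" "i + 5 < n" "c \<le> i" "i + 5 < d"
      using that XY(2) by (auto simp: J_def)
    note w = right_window_non_extrema[OF i(1,2)]
    show "{i+1, i+3, i+4} \<subseteq> ?N \<inter> Y" using w(1) i(3,4) by (simp add: Y)
    show "i + 2 \<notin> ?N" by (rule w(2))
    show "(x (i+1) < x (i+3)) \<noteq> (x (i+3) < x (i+4))" by (rule w(3))
  qed
  have consX: "consecutive_in C p q" if "consecutive_in F p q" for p q
    using that XY(1) by (fastforce simp: consecutive_in_def C F_def X Y)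
  have consE: "consecutive_in ?E p q" if "consecutive_in F p q" for p q
    using that by (fastforce simp: consecutive_in_def F_def X)
  have consY: "consecutive_in C p q" if "p \<in> ?N \<inter> Y" "q \<in> ?N \<inter> Y" "p < q" "{p<..<q} \<inter> ?N = {}" for p q
    using that XY(1) by (fastforce simp: consecutive_in_def C X Y)
  have "card (M1 \<union> M2) \<le> turns (map x (sorted_list_of_set C))"
  proof (rule card_le_turns[OF finC])
    fix q assume "q \<in> M1 \<union> M2"
    then consider "q \<in> M1" | i where "i \<in> I" "q = i + 2" | i where "i \<in> J" "q = i + 3"
      by (auto simp: M2_def)
    then show "\<exists>p r. consecutive_in C p q \<and> consecutive_in C q r \<and> (x p < x q) \<noteq> (x q < x r)"
    proof cases
      case 1
      then obtain p r where pr: "consecutive_in F p q" "consecutive_in F q r"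
        using consecutive_in_neighbours[OF finF] by (auto simp: M1_def)
      then have "(x p < x q) \<noteq> (x q < x r)"
        by (intro turn_at_extremum[of x n] consE)
      then show ?thesis using pr consX by blast
    next
      case (2 i)
      have "{i+1<..<i+2} = {}" "{i+2<..<i+4} = {i+3}" by auto
      then have "consecutive_in C (i+1) (i+2)" "consecutive_in C (i+2) (i+4)"
        using left[OF 2(1)] by (auto intro!: consY)
      then show ?thesis using left(3)[OF 2(1)] 2(2) by blast
    next
      case (3 i)
      have "{i+1<..<i+3} = {i+2}" "{i+3<..<i+4} = {}" by auto
      then have "consecutive_in C (i+1) (i+3)" "consecutive_in C (i+3) (i+4)"
        using right[OF 3(1)] by (auto intro!: consY)
      then show ?thesis using right(3)[OF 3(1)] 3(2) by blast
    qed
  qed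
  moreover have "card (M1 \<union> M2) = card M1 + card M2"
  proof (rule card_Un_disjoint)
    have "M1 \<subseteq> ?E" "M2 \<subseteq> ?N" using left(1) right(1) by (auto simp: M1_def M2_def F_def)
    then show "M1 \<inter> M2 = {}" using EN by blast
  qed (use finF finIJ in \<open>auto simp: M1_def M2_def\<close>)
  moreover have "card M2 = card I + card J"
  proof -
    have "(\<lambda>i. i + 2) ` I \<inter> (\<lambda>i. i + 3) ` J = {}"
    proof -
      have False if "i \<in> I" "j \<in> J" "i + 2 = j + 3" for i j
        using left_right_windows_disjoint[of x j] that by (auto simp: I_def J_def)
      then show ?thesis by blast
    qed
    then have "card M2 = card ((\<lambda>i. i + 2) ` I) + card ((\<lambda>i. i + 3) ` J)"
      unfolding M2_def by (intro card_Un_disjoint) (use finIJ in auto)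
    then show ?thesis by (simp add: card_image inj_on_def)
  qed
  moreover have "card F \<le> card M1 + 2"
  proof -
    have "card F - card {Min F, Max F} \<le> card M1"
      unfolding M1_def by (rule diff_card_le_card_Diff) simp
    moreover have "card {Min F, Max F} \<le> 2" by (simp add: card_insert_if)
    ultimately show ?thesis by linarith
  qed
  ultimately show ?thesis unfolding I_def[symmetric] J_def[symmetric] F_def[symmetric] by linarith
qed

section \<open>Exchanging the roles of the two halves\<close>

definition window_count :: "(nat \<Rightarrow> 'a::linorder) \<Rightarrow> nat \<Rightarrow> nat \<Rightarrow> nat" where
  "window_count x c d = card {i. c \<le> i \<and> i + 5 < d \<and> (peak_left x i \<or> valley_left x i)}
    + card {i. c \<le> i \<and> i + 5 < d \<and> (peak_right x i \<or> valley_right x i)}"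

text \<open>The summand 2 pays for the first and last extremum in the half where a twin follows the
  extrema. \<open>A\<close> and \<open>B\<close> are disjoint since they use opposite kinds of
  positions in each half.\<close>

theorem alpha_lower_bound:
  fixes xs :: "'a::linorder list"
  defines "n \<equiv> length xs" and "x \<equiv> (!) xs"
  assumes "h \<le> n"
    and "w + 2 \<le> card (extrema x n \<inter> {..<h}) + window_count x h n"
    and "w + 2 \<le> card (extrema x n \<inter> {h..<n}) + window_count x 0 h"
  shows "w \<le> alpha xs"
proof -
  define A where "A = extrema x n \<inter> {0..<h} \<union> non_extrema x n \<inter> {h..<n}"
  define B where "B = extrema x n \<inter> {h..<n} \<union> non_extrema x n \<inter> {0..<h}"
  have sub: "A \<subseteq> {..<length xs}" "B \<subseteq> {..<length xs}"
    using assms(3) by (auto simp: A_def B_def n_def)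
  have "w \<le> turns (map x (sorted_list_of_set A))"
    using turns_extrema_non_extrema[OF refl refl _ _ A_def] assms(4)
    by (simp add: window_count_def lessThan_atLeast0)
  moreover have "w \<le> turns (map x (sorted_list_of_set B))"
    using turns_extrema_non_extrema[OF refl refl _ assms(3) B_def] assms(5)
    by (simp add: window_count_def lessThan_atLeast0 Int_commute)
  moreover have "A \<inter> B = {}" by (auto simp: A_def B_def extrema_def non_extrema_def)
  ultimately show ?thesis
    using alpha_ge_turns[OF sub] nths_conv_map_nth[OF sub(1)] nths_conv_map_nth[OF sub(2)]
    by (simp add: x_def)
qed

section \<open>Evaluation of the pattern counts\<close>

lemma pattern_at_unique:
  assumes "order_pattern k \<sigma>" "order_pattern k \<tau>" "distinct xs" "i + k \<le> length xs"
    "pattern_at \<sigma> i xs" "pattern_at \<tau> i xs"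
  shows "\<sigma> = \<tau>"
proof -
  let ?g = "\<lambda>j. xs ! (i + j)"
  have "map ?g \<sigma> = map ?g \<tau>"
    by (rule strict_sorted_equal) (use assms in \<open>auto simp: pattern_at_def order_pattern_def\<close>)
  moreover have "inj_on ?g (set \<sigma> \<union> set \<tau>)"
    using assms by (auto simp: order_pattern_def inj_on_def nth_eq_iff_index_eq)
  ultimately show ?thesis by (simp add: inj_on_map_eq_map)
qed

text \<open>At most one pattern of length \<open>k\<close> fits a window of distinct entries, so the
  inner sum is an indicator.\<close>

lemma pattern_count_eq_card:
  assumes "finite S" "\<And>\<sigma>. \<sigma> \<in> S \<Longrightarrow> order_pattern k \<sigma>" "distinct xs" "I \<subseteq> {i. i + k \<le> length xs}"
  shows "pattern_count S I xs = real (card {i\<in>I. \<exists>\<sigma>\<in>S. pattern_at \<sigma> i xs})"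
proof -
  have "I \<subseteq> {..length xs}" using assms(4) by auto
  then have fin: "finite I" using finite_subset by blast
  have "(\<Sum>\<sigma>\<in>S. of_bool (pattern_at \<sigma> i xs)) = (of_bool (\<exists>\<sigma>\<in>S. pattern_at \<sigma> i xs) :: real)"
    if i: "i \<in> I" for i
  proof (cases "\<exists>\<sigma>\<in>S. pattern_at \<sigma> i xs")
    case True
    then obtain \<sigma> where \<sigma>: "\<sigma> \<in> S" "pattern_at \<sigma> i xs" by blast
    have "S \<inter> {\<sigma>. pattern_at \<sigma> i xs} = {\<sigma>}"
      using \<sigma> i assms(4) pattern_at_unique[OF assms(2) assms(2) assms(3)] by blast
    then show ?thesis using True assms(1) by simp
  qed (simp add: sum.neutral)
  then have "pattern_count S I xs = (\<Sum>i\<in>I. of_bool (\<exists>\<sigma>\<in>S. pattern_at \<sigma> i xs))"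
    unfolding pattern_count_def by (rule sum.cong[OF refl])
  also have "\<dots> = real (card {i\<in>I. \<exists>\<sigma>\<in>S. pattern_at \<sigma> i xs})"
    using fin by (simp add: Int_def)
  finally show ?thesis .
qed

section \<open>Explicit patterns and their densities\<close>

definition monotone_patterns :: "nat \<Rightarrow> nat list set" where
  "monotone_patterns k = {[0..<k], rev [0..<k]}"

lemma order_pattern_monotone: "\<sigma> \<in> monotone_patterns k \<Longrightarrow> order_pattern k \<sigma>"
  by (auto simp: monotone_patterns_def order_pattern_def)

lemma finite_monotone_patterns: "finite (monotone_patterns k)"
  by (simp add: monotone_patterns_def)

text \<open>The shuffles of \<open>[0,1]\<close> and \<open>[5,4]\<close>: the possible orders of the four outer entries of a
  window with a peak in the middle.\<close>

definition slopes :: "nat list set" where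
  "slopes = {[0,1,5,4], [0,5,1,4], [0,5,4,1], [5,0,1,4], [5,0,4,1], [5,4,0,1]}"

text \<open>The four families describe \<open>peak_left\<close>, \<open>peak_right\<close>,
  \<open>valley_left\<close> and \<open>valley_right\<close>, in this order; reversing a pattern
  reverses all inequalities.\<close>

definition window_patterns :: "nat list set" where
  "window_patterns = (\<lambda>s. s @ [2,3]) ` slopes \<union> (\<lambda>s. s @ [3,2]) ` slopes \<union>
     (\<lambda>s. [3,2] @ rev s) ` slopes \<union> (\<lambda>s. [2,3] @ rev s) ` slopes"

lemma finite_window_patterns: "finite window_patterns"
  by (simp add: window_patterns_def slopes_def)

lemma card_window_patterns: "card window_patterns = 24"
  by (simp add: window_patterns_def slopes_def)

lemma order_pattern_window: "\<sigma> \<in> window_patterns \<Longrightarrow> order_pattern 6 \<sigma>"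
  unfolding window_patterns_def slopes_def order_pattern_def by auto

lemma window_pattern_cases:
  assumes "\<sigma> \<in> window_patterns" "pattern_at \<sigma> i xs"
  shows "peak_left ((!) xs) i \<or> valley_left ((!) xs) i \<or> peak_right ((!) xs) i \<or> valley_right ((!) xs) i"
proof -
  from assms(1) consider s where "s \<in> slopes" "\<sigma> = s @ [2,3]" | s where "s \<in> slopes" "\<sigma> = s @ [3,2]"
    | s where "s \<in> slopes" "\<sigma> = [3,2] @ rev s" | s where "s \<in> slopes" "\<sigma> = [2,3] @ rev s"
    unfolding window_patterns_def by blast
  then show ?thesis
  proof cases
    case 1
    then have "peak_left ((!) xs) i"
      using assms(2) unfolding slopes_def pattern_at_def peak_left_def by auto
    then show ?thesis by simp
  next
    case 2
    then have "peak_right ((!) xs) i"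
      using assms(2) unfolding slopes_def pattern_at_def peak_right_def by auto
    then show ?thesis by simp
  next
    case 3
    then have "valley_left ((!) xs) i"
      using assms(2) unfolding slopes_def pattern_at_def valley_left_def by auto
    then show ?thesis by simp
  next
    case 4
    then have "valley_right ((!) xs) i"
      using assms(2) unfolding slopes_def pattern_at_def valley_right_def by auto
    then show ?thesis by simp
  qed
qed

lemma pattern_count_le_window_count:
  assumes "distinct xs" "d \<le> length xs"
  shows "pattern_count window_patterns {c..<d - 5} xs \<le> real (window_count ((!) xs) c d)"
proof -
  let ?x = "(!) xs"
  let ?L = "{i. c \<le> i \<and> i + 5 < d \<and> (peak_left ?x i \<or> valley_left ?x i)}"
  let ?R = "{i. c \<le> i \<and> i + 5 < d \<and> (peak_right ?x i \<or> valley_right ?x i)}"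
  have "?L \<subseteq> {..<d}" "?R \<subseteq> {..<d}" by auto
  then have "finite (?L \<union> ?R)" by (meson finite_UnI finite_lessThan finite_subset)
  moreover have "{i\<in>{c..<d - 5}. \<exists>\<sigma>\<in>window_patterns. pattern_at \<sigma> i xs} \<subseteq> ?L \<union> ?R"
    using window_pattern_cases[of _ _ xs] by fastforce
  ultimately have "card {i\<in>{c..<d - 5}. \<exists>\<sigma>\<in>window_patterns. pattern_at \<sigma> i xs} \<le> card (?L \<union> ?R)"
    by (rule card_mono)
  also have "\<dots> \<le> window_count ?x c d" unfolding window_count_def by (rule card_Un_le)
  finally show ?thesis
    by (subst pattern_count_eq_card[OF finite_window_patterns order_pattern_window])
      (use assms in auto)
qed

lemma pattern_count_le_mono5:
  assumes "distinct xs"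
  shows "pattern_count (monotone_patterns 5) {..<length xs - 4} xs
    \<le> real (card {i. i + 4 < length xs \<and> mono5_at ((!) xs) i})"
proof -
  have "mono5_at ((!) xs) i" if "\<sigma> \<in> monotone_patterns 5" "pattern_at \<sigma> i xs" for \<sigma> i
  proof -
    have split: "{i..<i+4} = {i, i+1, i+2, i+3}" by auto
    have l: "[0..<5] = [0,1,2,3,4::nat]" by (simp add: upt_rec)
    from that(1) consider "\<sigma> = [0,1,2,3,4]" | "\<sigma> = [4,3,2,1,0]"
      by (auto simp: monotone_patterns_def l)
    then show ?thesis
    proof cases
      case 1
      then have "run_on ((!) xs) i (i + 4) True"
        using that(2) unfolding run_on_def split by (auto simp: pattern_at_def eval_nat_numeral)
      then show ?thesis by (auto simp: mono5_at_def)
    next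
      case 2
      then have "run_on ((!) xs) i (i + 4) False"
        using that(2) unfolding run_on_def split by (auto simp: pattern_at_def eval_nat_numeral)
      then show ?thesis by (auto simp: mono5_at_def)
    qed
  qed
  then have "{i\<in>{..<length xs - 4}. \<exists>\<sigma>\<in>monotone_patterns 5. pattern_at \<sigma> i xs}
    \<subseteq> {i. i + 4 < length xs \<and> mono5_at ((!) xs) i}" by auto
  then have "card {i\<in>{..<length xs - 4}. \<exists>\<sigma>\<in>monotone_patterns 5. pattern_at \<sigma> i xs}
    \<le> card {i. i + 4 < length xs \<and> mono5_at ((!) xs) i}"
    by (rule card_mono[rotated]) (rule finite_subset[of _ "{..<length xs}"], auto)
  then show ?thesis
    by (subst pattern_count_eq_card[OF finite_monotone_patterns order_pattern_monotone])
      (use assms in auto)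
qed

text \<open>A position in \<open>{a<..b}\<close> that is no extremum is the middle of a monotone
  window of length three; distinctness excludes ties. Such windows have density 2/6, which leaves
  2/3 for the extrema.\<close>

lemma card_extrema_ge:
  assumes "distinct xs" "Suc b < length xs"
  shows "real (b - a) - pattern_count (monotone_patterns 3) {a..<b} xs
    \<le> real (card (extrema ((!) xs) (length xs) \<inter> {a<..b}))"
proof -
  let ?x = "(!) xs" and ?n = "length xs"
  let ?M = "{i\<in>{a..<b}. \<exists>\<sigma>\<in>monotone_patterns 3. pattern_at \<sigma> i xs}"
  have "{a<..b} \<subseteq> (extrema ?x ?n \<inter> {a<..b}) \<union> Suc ` ?M"
  proof
    fix q assume q: "q \<in> {a<..b}"
    then obtain i where i: "q = Suc i" "a \<le> i" "i < b" by (cases q) auto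
    show "q \<in> (extrema ?x ?n \<inter> {a<..b}) \<union> Suc ` ?M"
    proof (cases "q \<in> extrema ?x ?n")
      case False
      then have eq: "(?x i < ?x (i + 1)) = (?x (i + 1) < ?x (i + 2))"
        using i assms(2) by (auto simp: extrema_def)
      have ne: "?x i \<noteq> ?x (i + 1)" "?x (i + 1) \<noteq> ?x (i + 2)"
        using assms i by (auto simp: nth_eq_iff_index_eq)
      have "pattern_at [0,1,2] i xs \<or> pattern_at [2,1,0] i xs"
      proof (cases "?x i < ?x (i + 1)")
        case True
        then show ?thesis using eq by (auto simp: pattern_at_def)
      next
        case False
        then show ?thesis using eq ne by (auto simp: pattern_at_def)
      qed
      moreover have "[0..<3] = [0,1,2::nat]" by (simp add: upt_rec)
      ultimately have "i \<in> ?M" using i by (auto simp: monotone_patterns_def)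
      then show ?thesis using i by blast
    qed (use q in simp)
  qed
  then have "card {a<..b} \<le> card ((extrema ?x ?n \<inter> {a<..b}) \<union> Suc ` ?M)"
    by (rule card_mono[rotated]) auto
  also have "\<dots> \<le> card (extrema ?x ?n \<inter> {a<..b}) + card (Suc ` ?M)" by (rule card_Un_le)
  also have "card (Suc ` ?M) = card ?M" by (rule card_image) auto
  finally have "b - a \<le> card (extrema ?x ?n \<inter> {a<..b}) + card ?M" by simp
  moreover have "pattern_count (monotone_patterns 3) {a..<b} xs = real (card ?M)"
    by (rule pattern_count_eq_card[OF finite_monotone_patterns order_pattern_monotone])
      (use assms in auto)
  ultimately show ?thesis by linarith
qed

text \<open>All probabilistic input sits in the five hypotheses, with the densities 2/5!, 2/3! and
  24/6!. The constant 7/20 is half of 2/3 + 1/30, and 59/120 is 1/2 - 1/120; the additive constants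
  absorb boundary effects and rounding.\<close>

lemma alpha_bounds:
  fixes xs :: "nat list"
  defines "n \<equiv> length xs" and "h \<equiv> length xs div 2"
  assumes xs: "distinct xs" "12 \<le> n" and t: "0 \<le> t"
    and c1: "\<bar>pattern_count (monotone_patterns 5) {..<n - 4} xs - real (n - 4) / 60\<bar> \<le> t"
    and c2: "\<bar>pattern_count (monotone_patterns 3) {0..<h - 1} xs - real (h - 1) / 3\<bar> \<le> t"
    and c3: "\<bar>pattern_count (monotone_patterns 3) {h - 1..<n - 2} xs - real (n - 2 - (h - 1)) / 3\<bar> \<le> t"
    and c4: "\<bar>pattern_count window_patterns {0..<h - 5} xs - real (h - 5) / 30\<bar> \<le> t"
    and c5: "\<bar>pattern_count window_patterns {h..<n - 5} xs - real (n - 5 - h) / 30\<bar> \<le> t"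
  shows "7/20 * real n - 2 * t - 6 \<le> real (alpha xs)"
    and "real (alpha xs) \<le> 59/120 * real n + t + 1"
proof -
  have h: "6 \<le> h" "2 * real h \<le> real n" "real n \<le> 2 * real h + 1" "h + 6 \<le> n"
    using xs(2) by (auto simp: h_def n_def)
  have "real (2 * alpha xs + card {i. i + 4 < n \<and> mono5_at ((!) xs) i}) \<le> real n"
    using alpha_upper_bound[of xs] unfolding n_def of_nat_le_iff .
  then have "2 * real (alpha xs) + pattern_count (monotone_patterns 5) {..<n - 4} xs \<le> real n"
    using pattern_count_le_mono5[OF xs(1)] by (simp add: n_def)
  moreover have "real (n - 4) = real n - 4" using xs(2) by (simp add: of_nat_diff)
  ultimately show "real (alpha xs) \<le> 59/120 * real n + t + 1"
    using abs_le_D2[OF c1] t by linarith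

  let ?x = "(!) xs"
  \<comment> \<open>One more than the claimed bound, since \<open>w\<close> rounds down.\<close>
  define X where "X = 7/20 * real n - 2 * t - 5"
  define w where "w = nat \<lfloor>X\<rfloor>"
  have sub: "real (h - 1) = real h - 1" "real (n - 2) = real n - 2" "real (n - 5 - h) = real n - 5 - real h"
    "real (h - 5) = real h - 5" "real (n - 2 - (h - 1)) = real n - 1 - real h"
    using h by (simp_all add: of_nat_diff)
  have lin: "2/3 * u - t \<le> e" if "u - p \<le> e" "p - u / 3 \<le> t" for u p e :: real
    using that by linarith
  have "real (h - 1) - pattern_count (monotone_patterns 3) {0..<h - 1} xs
      \<le> real (card (extrema ?x n \<inter> {0<..h - 1}))"
    using card_extrema_ge[OF xs(1), of "h - 1" 0] h by (simp add: n_def)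
  also have "extrema ?x n \<inter> {0<..h - 1} = extrema ?x n \<inter> {..<h}"
    using h by (auto simp: extrema_def)
  finally have e1: "2/3 * real (h - 1) - t \<le> real (card (extrema ?x n \<inter> {..<h}))"
    using abs_le_D1[OF c2] by (rule lin)
  have "real (n - 2 - (h - 1)) - pattern_count (monotone_patterns 3) {h - 1..<n - 2} xs
      \<le> real (card (extrema ?x n \<inter> {h - 1<..n - 2}))"
    unfolding n_def by (rule card_extrema_ge[OF xs(1)]) (use h n_def in linarith)
  also have "extrema ?x n \<inter> {h - 1<..n - 2} = extrema ?x n \<inter> {h..<n}"
    using h by (auto simp: extrema_def)
  finally have e2: "2/3 * real (n - 2 - (h - 1)) - t \<le> real (card (extrema ?x n \<inter> {h..<n}))"
    using abs_le_D1[OF c3] by (rule lin)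
  have e3: "real (n - 5 - h) / 30 - t \<le> real (window_count ?x h n)"
    using pattern_count_le_window_count[OF xs(1), of n h] abs_le_D2[OF c5] by (simp add: n_def)
  have e4: "real (h - 5) / 30 - t \<le> real (window_count ?x 0 h)"
    using pattern_count_le_window_count[OF xs(1), of h 0] abs_le_D2[OF c4] by (simp add: h_def)
  have ar1: "7/20 * N - 2 * t - 5 + 2 \<le> e + v"
    if "2/3 * (H - 1) - t \<le> e" "(N - 5 - H) / 30 - t \<le> v" "2 * H \<le> N" "N \<le> 2 * H + 1"
    for N H e v :: real using that by (simp add: field_simps)
  have ar2: "7/20 * N - 2 * t - 5 + 2 \<le> e + v"
    if "2/3 * (N - 1 - H) - t \<le> e" "(H - 5) / 30 - t \<le> v" "2 * H \<le> N" "N \<le> 2 * H + 1"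
    for N H e v :: real using that by (simp add: field_simps)
  have "X + 2 \<le> real (card (extrema ?x n \<inter> {..<h})) + real (window_count ?x h n)"
    using e1 e3 h(2,3) unfolding sub X_def by (rule ar1)
  moreover have "X + 2 \<le> real (card (extrema ?x n \<inter> {h..<n})) + real (window_count ?x 0 h)"
    using e2 e4 h(2,3) unfolding sub X_def by (rule ar2)
  \<comment> \<open>For negative \<open>X\<close> the claimed bound is negative and holds
    trivially.\<close>
  ultimately have "w \<le> alpha xs" if "0 \<le> X"
  proof -
    have "real w \<le> X" using that by (simp add: w_def)
    then have "real (w + 2) \<le> real (card (extrema ?x n \<inter> {..<h}) + window_count ?x h n)"
      "real (w + 2) \<le> real (card (extrema ?x n \<inter> {h..<n}) + window_count ?x 0 h)"
      using \<open>X + 2 \<le> real (card (extrema ?x n \<inter> {..<h})) + real (window_count ?x h n)\<close>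
        \<open>X + 2 \<le> real (card (extrema ?x n \<inter> {h..<n})) + real (window_count ?x 0 h)\<close> by simp_all
    then show "w \<le> alpha xs"
      using alpha_lower_bound[of h xs w] h unfolding of_nat_le_iff n_def by simp
  qed
  moreover have "X - 1 \<le> real w" if "0 \<le> X" unfolding w_def using that by linarith
  ultimately show "7/20 * real n - 2 * t - 6 \<le> real (alpha xs)"
    unfolding X_def by (cases "0 \<le> X") (auto simp: X_def)
qed

section \<open>Passage to the limit\<close>

lemma prob_Union_list_le:
  assumes "\<And>b. b \<in> set B \<Longrightarrow> measure_pmf.prob M b \<le> c"
  shows "measure_pmf.prob M (\<Union>b\<in>set B. b) \<le> real (length B) * c"
  using assms
proof (induction B)
  case (Cons b B)
  have "measure_pmf.prob M (\<Union>b\<in>set (b # B). b)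
      \<le> measure_pmf.prob M b + measure_pmf.prob M (\<Union>b\<in>set B. b)"
    by (simp add: measure_Un_le)
  also have "\<dots> \<le> c + real (length B) * c"
    by (intro add_mono Cons.IH Cons.prems) auto
  finally show ?case by (simp add: algebra_simps)
qed simp

theorem theorem2:
  shows "\<exists>\<epsilon> \<delta> :: nat \<Rightarrow> real. \<epsilon> \<in> o(\<lambda>_. 1) \<and> \<delta> \<in> o(\<lambda>_. 1) \<and>
    (\<lambda>n. measure_pmf.prob (random_permutation n)
       {\<pi>. (1/3 + 1/60 + \<epsilon> n) * real n \<le> real (alpha \<pi>) \<and>
           real (alpha \<pi>) \<le> (1/2 - 1/120 + \<delta> n) * real n}) \<longlonglongrightarrow> 1"
proof -
  \<comment> \<open>An order strictly between the square root of \<open>n\<close> and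
    \<open>n\<close>: the relative error \<open>t n / n\<close> tends to 0, and so does the
    Chebyshev bound of order \<open>n / (t n)^2\<close>.\<close>
  define t where "t n = real n powr (3/4)" for n
  define \<epsilon> where "\<epsilon> n = - (2 * t n + 6) / real n" for n
  define \<delta> where "\<delta> n = (t n + 1) / real n" for n
  define T where "T n = {\<pi> :: nat list. (1/3 + 1/60 + \<epsilon> n) * real n \<le> real (alpha \<pi>) \<and>
           real (alpha \<pi>) \<le> (1/2 - 1/120 + \<delta> n) * real n}" for n
  define P where "P n = measure_pmf.prob (random_permutation n)" for n
  have "\<epsilon> \<in> o(\<lambda>_. 1)" unfolding \<epsilon>_def t_def by real_asymp
  moreover have "\<delta> \<in> o(\<lambda>_. 1)" unfolding \<delta>_def t_def by real_asymp
  moreover have "(\<lambda>n. P n (T n)) \<longlonglongrightarrow> 1"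
  proof (rule tendsto_sandwich)
    show "(\<lambda>n. 1 - 5 * (6912 * real n / (t n)\<^sup>2)) \<longlonglongrightarrow> 1" unfolding t_def by real_asymp
    show "\<forall>\<^sub>F n in sequentially. P n (T n) \<le> 1" by (simp add: P_def)
    show "\<forall>\<^sub>F n in sequentially. 1 - 5 * (6912 * real n / (t n)\<^sup>2) \<le> P n (T n)"
      using eventually_ge_at_top[of 12]
    proof eventually_elim
      case (elim n)
      define bad where "bad S k I = {xs :: nat list.
        t n \<le> \<bar>pattern_count S I xs - real (card I) * (real (card S) / fact k)\<bar>}" for S k I
      have t0: "0 < t n" using elim by (simp add: t_def)
      \<comment> \<open>One bound for all five families: 6912 is \<open>2 * 6 * 24 ^ 2\<close>, from
        windows of length at most 6 and at most 24 patterns.\<close>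
      have bad: "P n (bad S k I) \<le> 6912 * real n / (t n)\<^sup>2"
        if "finite S" "\<And>\<sigma>. \<sigma> \<in> S \<Longrightarrow> order_pattern k \<sigma>" "I \<subseteq> {i. i + k \<le> n} \<inter> {..<n}"
          "k \<le> 6" "card S \<le> 24" for S k I
      proof -
        have "card I \<le> card {..<n}" by (rule card_mono) (use that in auto)
        then have "real k * real (card S) ^ 2 * real (card I) \<le> 6 * 24 ^ 2 * real n"
          using that by (intro mult_mono power_mono) auto
        then have "2 * real k * real (card S) ^ 2 * real (card I) / (t n)\<^sup>2 \<le> 6912 * real n / (t n)\<^sup>2"
          by (intro divide_right_mono) (auto simp: mult_ac)
        moreover have "P n (bad S k I) \<le> 2 * real k * real (card S) ^ 2 * real (card I) / (t n)\<^sup>2"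
          unfolding P_def bad_def by (rule pattern_count_concentration) (use that t0 in auto)
        ultimately show ?thesis by linarith
      qed
      define h where "h = n div 2"
      define B where "B = [bad (monotone_patterns 5) 5 {..<n - 4},
        bad (monotone_patterns 3) 3 {0..<h - 1}, bad (monotone_patterns 3) 3 {h - 1..<n - 2},
        bad window_patterns 6 {0..<h - 5}, bad window_patterns 6 {h..<n - 5}]"
      have cS: "card (monotone_patterns 5) = 2" "card (monotone_patterns 3) = 2" "card window_patterns = 24"
        by (simp_all add: monotone_patterns_def upt_rec card_window_patterns)
      have fact: "fact 3 = (6::real)" "fact 5 = (120::real)" "fact 6 = (720::real)"
        by (simp_all add: fact_numeral)
      \<comment> \<open>Off the five bad events \<open>alpha_bounds\<close> applies; membership in
        the support supplies distinctness and length \<open>n\<close>.\<close>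
      have "set_pmf (random_permutation n) - T n \<subseteq> (\<Union>b\<in>set B. b)"
      proof
        fix xs assume xs: "xs \<in> set_pmf (random_permutation n) - T n"
        show "xs \<in> (\<Union>b\<in>set B. b)"
        proof (rule ccontr)
          assume nb: "xs \<notin> (\<Union>b\<in>set B. b)"
          have "xs \<in> permutations_of_set {1..n}"
            using xs by (simp add: random_permutation_def)
          then have d: "distinct xs" "length xs = n"
            by (auto simp: permutations_of_set_def distinct_card[symmetric])
          have good: "\<bar>pattern_count (monotone_patterns 5) {..<n - 4} xs - real (n - 4) / 60\<bar> \<le> t n"
            "\<bar>pattern_count (monotone_patterns 3) {0..<h - 1} xs - real (h - 1) / 3\<bar> \<le> t n"
            "\<bar>pattern_count (monotone_patterns 3) {h - 1..<n - 2} xs - real (n - 2 - (h - 1)) / 3\<bar> \<le> t n"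
            "\<bar>pattern_count window_patterns {0..<h - 5} xs - real (h - 5) / 30\<bar> \<le> t n"
            "\<bar>pattern_count window_patterns {h..<n - 5} xs - real (n - 5 - h) / 30\<bar> \<le> t n"
            using nb unfolding B_def bad_def by (simp_all add: cS fact)
          have "7/20 * real n - 2 * t n - 6 \<le> real (alpha xs)"
            "real (alpha xs) \<le> 59/120 * real n + t n + 1"
            by (rule alpha_bounds[of xs "t n", unfolded d(2), folded h_def, OF d(1) elim _ good],
                use t0 in simp)+
          moreover have \<epsilon>\<delta>: "\<epsilon> n * real n = - (2 * t n + 6)" "\<delta> n * real n = t n + 1"
            unfolding \<epsilon>_def \<delta>_def times_divide_eq_left
            using elim by (intro nonzero_mult_div_cancel_right; simp)+
          ultimately have "xs \<in> T n"
            unfolding T_def mem_Collect_eq distrib_right \<epsilon>\<delta> by simp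
          with xs show False by simp
        qed
      qed
      \<comment> \<open>The inclusion is known only on the support, so \<open>- T n\<close> is first
        intersected with it.\<close>
      then have "P n (- T n) \<le> P n (\<Union>b\<in>set B. b)"
        unfolding P_def
        by (subst measure_Int_set_pmf[symmetric]) (rule measure_pmf.finite_measure_mono, auto)
      also have "\<dots> \<le> real (length B) * (6912 * real n / (t n)\<^sup>2)"
        unfolding P_def
      proof (rule prob_Union_list_le)
        fix b assume "b \<in> set B"
        then show "measure_pmf.prob (random_permutation n) b \<le> 6912 * real n / (t n)\<^sup>2"
          unfolding B_def P_def[symmetric] using elim
          by (auto simp: cS h_def intro!: bad finite_monotone_patterns finite_window_patterns
              order_pattern_monotone order_pattern_window)
      qed
      finally have "P n (- T n) \<le> 5 * (6912 * real n / (t n)\<^sup>2)" by (simp add: B_def)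
      moreover have "P n (- T n) = 1 - P n (T n)"
        unfolding P_def using measure_pmf.prob_compl[of "T n" "random_permutation n"]
        by (simp add: Compl_eq_Diff_UNIV)
      ultimately show ?case by linarith
    qed
  qed (auto)
  ultimately show ?thesis unfolding T_def P_def by blast
qed

end
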